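(* Let $\lambda$ be a nonempty partition with $m_i$ parts of size $i$ for all $i\ge1$. Then $$\sum_{j=0}^{|\lambda|-1} Q_{\lambda,j }\, t^j = \prod_{i\ge 1} h_{m_i}\Big[ \sum_{j=0}^{i-1} Q_{(i), j}\, t^j\Big].$$ Consequently, $$\sum_{n,j \ge 0} Q_{n,j }\, t^j z^n = \sum_{n\ge 0} h_n\Big[\sum_{i\ge 1,\, j\ge 0}Q_{(i), j}\, t^j z^i \Big] .$$
   Context: For $n\ge1$, $\mathfrak S_n$ is the symmetric group on $[n]=\{1,\dots,n\}$, and $\sigma\in\mathfrak S_n$ is written $\sigma_1\cdots\sigma_n$ with $\sigma_i=\sigma(i)$. $\mathrm{EXC}(\sigma)=\{i\in[n-1]:\sigma_i>i\}$, $\mathrm{exc}(\sigma)=|\mathrm{EXC}(\sigma)|$, and $\lambda(\sigma)$ is the cycle type of $\sigma$. Totally order the alphabet $[n]\cup\{\bar1,\dots,\bar n\}$ by $\bar1<\cdots<\bar n<1<\cdots<n$. Let $\bar\sigma$ be the word obtained from $\sigma_1\cdots\sigma_n$ by replacing $\sigma_i$ with $\overline{\sigma_i}$ for each $i\in\mathrm{EXC}(\sigma)$, and let $\mathrm{DEX}(\sigma)$ be the set of $i\in[n-1]$ such that the $i$th letter of $\bar\sigma$ is larger than the $(i+1)$st. For $S\subseteq[n-1]$, $F_{S,n}(\mathbf x)=\sum x_{i_1}\cdots x_{i_n}$, summed over all $i_1\ge\cdots\ge i_n\ge1$ with $i_j>i_{j+1}$ whenever $j\in S$. For $n\ge1$,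 $Q_{n,j}=\sum F_{\mathrm{DEX}(\sigma),n}$ summed over $\sigma\in\mathfrak S_n$ with $\mathrm{exc}(\sigma)=j$; for $\lambda\vdash n$, $Q_{\lambda,j}$ is the same sum restricted to $\sigma$ with $\lambda(\sigma)=\lambda$. Also $Q_{0,0}=1$ and $Q_{0,j}=0$ for $j>0$. $(i)$ denotes the partition with the single part $i$, and $|\lambda|$ is the sum of the parts of $\lambda$. $h_m$ is the complete homogeneous symmetric function ($h_0=1$). Plethysm: for a symmetric function $f$ in $x_1,x_2,\dots$ and a formal power series $g$ with positive integer coefficients (here $g$ is a series in $x_1,x_2,\dots$ and $t$, or $x_1,x_2,\dots$, $t$ and $z$), list the monomials of $g$ in any order, each repeated as many times as its coefficient; $f[g]$ is obtained from $f$ by replacing $x_i$ with the $i$th monomial in the list, for each $i$. *)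

theory Defs
  imports
    "HOL-Library.Multiset"
    "HOL-Library.Countable_Set"
    "HOL-Combinatorics.Orbits"
begin

section \<open>Formal power series in arbitrarily many variables\<close>

text \<open>
  A monomial in variables from \<open>'v\<close> is a finite multiset of variables (the multiplicity is the
  exponent, multiset union is multiplication of monomials). A formal power series with integer
  coefficients assigns an integer to every monomial, without any finiteness condition.
\<close>

typedef 'v mfps = "UNIV :: ('v multiset \<Rightarrow> int) set"
  morphisms mcoeff Abs_mfps
  by simp

setup_lifting type_definition_mfps

lemma mfps_eqI: "(\<And>u. mcoeff f u = mcoeff g u) \<Longrightarrow> f = g"
  by (metis ext mcoeff_inject)

lemma finite_submultisets: "finite {a. a \<subseteq># (u :: 'v multiset)}"
proof (rule finite_subset)
  show "{a. a \<subseteq># u} \<subseteq> mset ` {xs. set xs \<subseteq> set_mset u \<and> length xs \<le> size u}"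
  proof
    fix a assume "a \<in> {a. a \<subseteq># u}"
    then have a: "a \<subseteq># u" by simp
    obtain xs where "a = mset xs" by (metis ex_mset)
    with a show "a \<in> mset ` {xs. set xs \<subseteq> set_mset u \<and> length xs \<le> size u}"
      using set_mset_mono[OF a] size_mset_mono[OF a] by auto
  qed
  show "finite (mset ` {xs. set xs \<subseteq> set_mset u \<and> length xs \<le> size u})"
    by (intro finite_imageI finite_lists_length_le) simp
qed

lemma finite_monomial_splits: "finite {(a, b). a + b = (u :: 'v multiset)}"
  by (rule finite_subset[of _ "{a. a \<subseteq># u} \<times> {b. b \<subseteq># u}"])
     (auto simp: finite_submultisets)

instantiation mfps :: (type) comm_ring_1
begin

lift_definition zero_mfps :: "'a mfps" is "\<lambda>_. 0" .
lift_definition one_mfps :: "'a mfps" is "\<lambda>u. if u = {#} then 1 else 0" .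
lift_definition plus_mfps :: "'a mfps \<Rightarrow> 'a mfps \<Rightarrow> 'a mfps" is "\<lambda>f g u. f u + g u" .
lift_definition minus_mfps :: "'a mfps \<Rightarrow> 'a mfps \<Rightarrow> 'a mfps" is "\<lambda>f g u. f u - g u" .
lift_definition uminus_mfps :: "'a mfps \<Rightarrow> 'a mfps" is "\<lambda>f u. - f u" .
lift_definition times_mfps :: "'a mfps \<Rightarrow> 'a mfps \<Rightarrow> 'a mfps" is
  "\<lambda>f g u. \<Sum>(a, b) | a + b = u. f a * g b" .

instance
proof
  fix f g h :: "'a mfps"
  show "f + g + h = f + (g + h)" by transfer (simp add: add.assoc)
  show "f + g = g + f" by transfer (simp add: add.commute)
  show "0 + f = f" by transfer simp
  show "- f + f = 0" by transfer simp
  show "f - g = f + - g" by transfer simp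
  show "(0 :: 'a mfps) \<noteq> 1" by transfer (auto simp: fun_eq_iff)
  show "f * g = g * f"
    by transfer (auto simp: fun_eq_iff add.commute mult.commute
        intro!: sum.reindex_bij_witness[of _ "\<lambda>(a, b). (b, a)" "\<lambda>(a, b). (b, a)"])
  show "1 * f = f"
  proof (transfer, rule ext)
    fix f :: "'a multiset \<Rightarrow> int" and u
    have "(\<Sum>(a, b) | a + b = u. (if a = {#} then 1 else 0) * f b)
        = (\<Sum>(a, b) \<in> {({#} :: 'a multiset, u)}. (if a = {#} then 1 else 0) * f b)"
      by (rule sum.mono_neutral_right) (auto simp: finite_monomial_splits split: if_splits)
    then show "(\<Sum>(a, b) | a + b = u. (if a = {#} then 1 else 0) * f b) = f u" by simp
  qed
  show "(f + g) * h = f * h + g * h"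
    by transfer (auto simp: fun_eq_iff sum.distrib[symmetric] algebra_simps intro!: sum.cong)
  show "f * g * h = f * (g * h)"
  proof (transfer, rule ext)
    fix f g h :: "'a multiset \<Rightarrow> int" and u
    have "(\<Sum>(a, b) | a + b = u. (\<Sum>(c, d) | c + d = a. f c * g d) * h b)
        = (\<Sum>((a, b), (c, d)) \<in> (SIGMA (a, b) : {(a, b). a + b = u}. {(c, d). c + d = a}).
            f c * g d * h b)"
      by (subst sum.Sigma[symmetric])
         (auto simp: finite_monomial_splits[unfolded case_prod_unfold] sum_distrib_right case_prod_unfold intro!: sum.cong)
    also have "\<dots> = (\<Sum>((a, b), (c, d)) \<in> (SIGMA (a, b) : {(a, b). a + b = u}. {(c, d). c + d = b}).
            f a * (g c * h d))"
      by (rule sum.reindex_bij_witness[of _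
            "\<lambda>((a, b), (c, d)). ((a + c, d), (a, c))" "\<lambda>((a, b), (c, d)). ((c, d + b), (d, b))"])
         (auto simp: add.assoc mult.assoc)
    also have "\<dots> = (\<Sum>(a, b) | a + b = u. f a * (\<Sum>(c, d) | c + d = b. g c * h d))"
      by (subst sum.Sigma[symmetric])
         (auto simp: finite_monomial_splits[unfolded case_prod_unfold] sum_distrib_left case_prod_unfold intro!: sum.cong)
    finally show "(\<Sum>(a, b) | a + b = u. (\<Sum>(c, d) | c + d = a. f c * g d) * h b)
        = (\<Sum>(a, b) | a + b = u. f a * (\<Sum>(c, d) | c + d = b. g c * h d))" .
  qed
qed

end

lift_definition monom :: "'v multiset \<Rightarrow> 'v mfps" is "\<lambda>v u. if u = v then 1 else 0" .

abbreviation mvar :: "'v \<Rightarrow> 'v mfps" where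
  "mvar v \<equiv> monom {#v#}"

text \<open>
  Infinite sums are taken coefficientwise; this is meaningful if each coefficient receives only
  finitely many nonzero contributions.
\<close>

definition formal_summable :: "('i \<Rightarrow> 'v mfps) \<Rightarrow> 'i set \<Rightarrow> bool" where
  "formal_summable f I \<longleftrightarrow> (\<forall>u. finite {i \<in> I. mcoeff (f i) u \<noteq> 0})"

lift_definition formal_sum :: "('i \<Rightarrow> 'v mfps) \<Rightarrow> 'i set \<Rightarrow> 'v mfps" is
  "\<lambda>f I u. \<Sum>i \<in> {i \<in> I. f i u \<noteq> 0}. f i u" .

section \<open>Plethysm\<close>

text \<open>
  A listing of the monomials of \<open>g\<close>, each repeated according to its coefficient. The value
  \<open>None\<close> marks the positions behind the end of a finite list; the corresponding variables of the
  symmetric function are replaced by \<open>0\<close>.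
\<close>

definition is_listing :: "(nat \<Rightarrow> 'v multiset option) \<Rightarrow> 'v mfps \<Rightarrow> bool" where
  "is_listing e g \<longleftrightarrow>
     (\<forall>u. finite {i. e i = Some u} \<and> int (card {i. e i = Some u}) = mcoeff g u) \<and>
     (\<forall>i j. i \<le> j \<longrightarrow> e i = None \<longrightarrow> e j = None)"

definition listing_entry :: "(nat \<Rightarrow> 'v multiset option) \<Rightarrow> nat \<Rightarrow> 'v mfps" where
  "listing_entry e i = (case e i of None \<Rightarrow> 0 | Some u \<Rightarrow> monom u)"

definition subst_listing :: "nat mfps \<Rightarrow> (nat \<Rightarrow> 'v multiset option) \<Rightarrow> 'v mfps" where
  "subst_listing f e =
     formal_sum (\<lambda>a. of_int (mcoeff f a) * (\<Prod>i\<in>#a. listing_entry e i)) UNIV"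

text \<open>
  Symmetric functions live in the type \<^typ>\<open>nat mfps\<close>, where the index \<open>i\<close> stands for the
  variable \<open>x\<^bsub>i+1\<^esub>\<close>. For symmetric \<open>f\<close> the choice of the listing is irrelevant
  (\<open>plethysm_eq\<close> below).
\<close>

definition plethysm :: "nat mfps \<Rightarrow> 'v mfps \<Rightarrow> 'v mfps" where
  "plethysm f g = subst_listing f (SOME e. is_listing e g)"

text \<open>The sum of all monomials of degree \<open>m\<close>.\<close>

lift_definition hsym :: "nat \<Rightarrow> nat mfps" is "\<lambda>m u. if size u = m then 1 else 0" .

definition symmetric_mfps :: "nat mfps \<Rightarrow> bool" where
  "symmetric_mfps f \<longleftrightarrow> (\<forall>p u. bij p \<longrightarrow> mcoeff f (image_mset p u) = mcoeff f u)"

section \<open>Permutation statistics\<close>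

definition EXC :: "nat \<Rightarrow> (nat \<Rightarrow> nat) \<Rightarrow> nat set" where
  "EXC n \<sigma> = {i \<in> {1..n-1}. \<sigma> i > i}"

definition exc :: "nat \<Rightarrow> (nat \<Rightarrow> nat) \<Rightarrow> nat" where
  "exc n \<sigma> = card (EXC n \<sigma>)"

datatype letter = Barred nat | Plain nat

fun letter_less :: "letter \<Rightarrow> letter \<Rightarrow> bool" where
  "letter_less (Barred a) (Barred b) \<longleftrightarrow> a < b"
| "letter_less (Barred a) (Plain b) \<longleftrightarrow> True"
| "letter_less (Plain a) (Barred b) \<longleftrightarrow> False"
| "letter_less (Plain a) (Plain b) \<longleftrightarrow> a < b"

definition bar_word :: "nat \<Rightarrow> (nat \<Rightarrow> nat) \<Rightarrow> nat \<Rightarrow> letter" where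
  "bar_word n \<sigma> i = (if i \<in> EXC n \<sigma> then Barred (\<sigma> i) else Plain (\<sigma> i))"

definition DEX :: "nat \<Rightarrow> (nat \<Rightarrow> nat) \<Rightarrow> nat set" where
  "DEX n \<sigma> = {i \<in> {1..n-1}. letter_less (bar_word n \<sigma> (i + 1)) (bar_word n \<sigma> i)}"

text \<open>Fixed points are orbits of size 1 and contribute parts 1.\<close>

definition cycle_type :: "nat \<Rightarrow> (nat \<Rightarrow> nat) \<Rightarrow> nat multiset" where
  "cycle_type n \<sigma> = image_mset card (mset_set (orbit \<sigma> ` {1..n}))"

section \<open>Eulerian quasisymmetric functions\<close>

text \<open>As above, \<open>X i\<close> stands for \<open>x\<^bsub>i+1\<^esub>\<close>.\<close>

datatype var = X nat | T | Z

text \<open>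
  The word \<open>w\<close> is \<open>i\<^sub>1, \<dots>, i\<^sub>n\<close>; list positions start at 0, so \<open>i\<^sub>j\<close> is
  \<open>w ! (j - 1)\<close>.
\<close>

definition fqs_words :: "nat set \<Rightarrow> nat \<Rightarrow> nat list set" where
  "fqs_words S n =
     {w. length w = n \<and> sorted_wrt (\<ge>) w \<and> (\<forall>j\<in>S. w ! (j - 1) > w ! j)}"

definition Fqs :: "nat set \<Rightarrow> nat \<Rightarrow> var mfps" where
  "Fqs S n = formal_sum (\<lambda>w. \<Prod>i\<leftarrow>w. mvar (X i)) (fqs_words S n)"

definition Qn :: "nat \<Rightarrow> nat \<Rightarrow> var mfps" where
  "Qn n j =
     (if n = 0 then (if j = 0 then 1 else 0)
      else (\<Sum>\<sigma> | \<sigma> permutes {1..n} \<and> exc n \<sigma> = j. Fqs (DEX n \<sigma>) n))"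

definition is_partition :: "nat multiset \<Rightarrow> bool" where
  "is_partition lam \<longleftrightarrow> 0 \<notin># lam"

definition Qlam :: "nat multiset \<Rightarrow> nat \<Rightarrow> var mfps" where
  "Qlam lam j =
     (let n = sum_mset lam in
      \<Sum>\<sigma> | \<sigma> permutes {1..n} \<and> exc n \<sigma> = j \<and> cycle_type n \<sigma> = lam. Fqs (DEX n \<sigma>) n)"

section \<open>Well-definedness of the infinite sums and of plethysm\<close>

lemma mcoeff_0 [simp]: "mcoeff 0 u = 0"
  by transfer simp

lemma mcoeff_1: "mcoeff 1 u = (if u = {#} then 1 else 0)"
  by transfer simp

lemma mcoeff_add [simp]: "mcoeff (f + g) u = mcoeff f u + mcoeff g u"
  by transfer simp

lemma mcoeff_sum: "mcoeff (\<Sum>i\<in>I. f i) u = (\<Sum>i\<in>I. mcoeff (f i) u)"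
  by (induction I rule: infinite_finite_induct) auto

lemma mcoeff_monom: "mcoeff (monom v) u = (if u = v then 1 else 0)"
  by transfer simp

lemma mcoeff_formal_sum: "mcoeff (formal_sum f I) u = (\<Sum>i \<in> {i \<in> I. mcoeff (f i) u \<noteq> 0}. mcoeff (f i) u)"
  by transfer simp

lemma monom_empty: "monom {#} = 1"
  by transfer (simp add: fun_eq_iff)

lemma mcoeff_mult_monom:
  "mcoeff (f * monom v) u = (if v \<subseteq># u then mcoeff f (u - v) else 0)"
proof (transfer fixing: u v)
  fix f :: "'a multiset \<Rightarrow> int"
  have "(\<Sum>(a, b) | a + b = u. f a * (if b = v then 1 else 0))
      = (\<Sum>(a, b) \<in> (if v \<subseteq># u then {(u - v, v)} else {}). f a * (if b = v then 1 else 0))"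
    by (rule sum.mono_neutral_right) (auto simp: finite_monomial_splits split: if_splits)
  then show "(\<Sum>(a, b) | a + b = u. f a * (if b = v then 1 else 0))
      = (if v \<subseteq># u then f (u - v) else 0)" by simp
qed

lemma monom_mult: "monom v * monom w = monom (v + w)"
  by (rule mfps_eqI) (auto simp: mcoeff_mult_monom mcoeff_monom subset_mset.le_iff_add add.commute)

lemma mvar_power: "mvar v ^ k = monom (replicate_mset k v)"
  by (induction k) (simp_all add: monom_empty monom_mult)

lemma mcoeff_of_nat_mult: "mcoeff (of_nat k * f) u = int k * mcoeff f u"
  by (induction k) (simp_all add: algebra_simps)

lemma mcoeff_uminus [simp]: "mcoeff (- f) u = - mcoeff f u"
  by transfer simp

lemma mcoeff_of_int_mult: "mcoeff (of_int k * f) u = k * mcoeff f u"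
  by (cases k rule: int_cases2) (simp_all add: mcoeff_of_nat_mult)

lemma prod_listing_entry:
  "(\<Prod>i\<in>#a. listing_entry e i) =
     (if \<forall>i\<in>#a. e i \<noteq> None then monom (\<Sum>i\<in>#a. the (e i)) else 0)"
  by (induction a) (auto simp: monom_empty monom_mult listing_entry_def split: option.splits)

lemma mcoeff_subst_term:
  "mcoeff (of_int c * (\<Prod>i\<in>#a. listing_entry e i)) u =
     (if (\<forall>i\<in>#a. e i \<noteq> None) \<and> (\<Sum>i\<in>#a. the (e i)) = u then c else 0)"
  by (auto simp: mcoeff_of_int_mult prod_listing_entry mcoeff_monom)

lemma mcoeff_subst_listing:
  "mcoeff (subst_listing f e) u =
     (\<Sum>a | (\<forall>i\<in>#a. e i \<noteq> None) \<and> (\<Sum>i\<in>#a. the (e i)) = u \<and> mcoeff f a \<noteq> 0. mcoeff f a)"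
  by (auto simp: subst_listing_def mcoeff_formal_sum mcoeff_subst_term intro!: sum.cong)

lemma countable_multisets: "countable (UNIV :: 'v :: countable multiset set)"
proof -
  have "(UNIV :: 'v multiset set) = range mset" by (metis surj_mset)
  then show ?thesis by (metis countable_image uncountable_def countableI_type)
qed

lemma is_listing_exists:
  fixes g :: "'v :: countable mfps"
  assumes nonneg: "\<And>u. mcoeff g u \<ge> 0"
  shows "\<exists>e. is_listing e g"
proof -
  define C where "C = (SIGMA u : UNIV. {..< nat (mcoeff g u)})"
  have cC: "countable C" unfolding C_def by (intro countable_SIGMA countable_multisets) auto
  obtain b J where b: "bij_betw b J C" and J: "\<And>i j :: nat. i \<le> j \<Longrightarrow> j \<in> J \<Longrightarrow> i \<in> J"
  proof (cases "finite C")
    case True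
    show ?thesis by (rule that[OF bij_betw_from_nat_into_finite[OF True]]) auto
  next
    case False
    show ?thesis by (rule that[OF bij_betw_from_nat_into[OF cC False]]) auto
  qed
  define e where "e i = (if i \<in> J then Some (fst (b i)) else None)" for i
  have fibre: "bij_betw b {i. e i = Some u} ({u} \<times> {..< nat (mcoeff g u)})" for u
  proof -
    have "{u} \<times> {..< nat (mcoeff g u)} = b ` {i. e i = Some u}"
    proof safe
      fix k assume "k < nat (mcoeff g u)"
      then have "(u, k) \<in> C" by (simp add: C_def)
      then obtain i where "i \<in> J" "b i = (u, k)" using b by (metis bij_betw_def imageE)
      then show "(u, k) \<in> b ` {i. e i = Some u}" by (force simp: e_def image_iff)
    next
      fix v k i assume "(v, k) = b i" "e i = Some u"
      then have "(v, k) \<in> C" "v = u" using b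
        by (auto simp: e_def bij_betw_def split: if_splits) (metis fst_conv)
      then show "v = u" "k < nat (mcoeff g u)" by (auto simp: C_def)
    qed
    moreover have "inj_on b {i. e i = Some u}"
      using b by (auto simp: bij_betw_def e_def intro: inj_on_subset split: if_splits)
    ultimately show ?thesis by (simp add: bij_betw_def)
  qed
  have "finite {i. e i = Some u} \<and> int (card {i. e i = Some u}) = mcoeff g u" for u
    using bij_betw_finite[OF fibre[of u]] bij_betw_same_card[OF fibre[of u]] nonneg[of u]
    by (simp add: card_cartesian_product)
  then have "is_listing e g" unfolding is_listing_def by (auto simp: e_def dest: J)
  then show ?thesis by blast
qed

lemma listing_rearrange:
  assumes e: "is_listing e g" and e': "is_listing e' g"
  obtains p where "bij p" "\<And>i. e' (p i) = e i"
proof -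
  have same: "card {i. e i = Some u} = card {i. e' i = Some u}"
    and fin: "finite {i. e i = Some u}" "finite {i. e' i = Some u}" for u
    using e e' unfolding is_listing_def by (metis of_nat_eq_iff)+
  have "\<exists>q. bij_betw q {i. e i = Some u} {i. e' i = Some u}" for u
    using same fin finite_same_card_bij by blast
  then obtain q where q: "\<And>u. bij_betw (q u) {i. e i = Some u} {i. e' i = Some u}" by metis
  define D D' where "D = {i. e i \<noteq> None}" and "D' = {i. e' i \<noteq> None}"
  define r where "r i = q (the (e i)) i" for i
  have r: "e' (r i) = e i" if "i \<in> D" for i
    using that bij_betwE[OF q[of "the (e i)"]] by (auto simp: D_def r_def)
  have inj: "inj_on r D"
  proof (rule inj_onI)
    fix i j assume ij: "i \<in> D" "j \<in> D" "r i = r j"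
    then have "e i = e j" using r by metis
    then show "i = j" using ij bij_betw_imp_inj_on[OF q[of "the (e i)"]]
      by (auto simp: D_def r_def inj_on_def)
  qed
  have img: "r ` D = D'"
  proof safe
    fix i assume "i \<in> D" then show "r i \<in> D'" using r by (auto simp: D_def D'_def)
  next
    fix k assume "k \<in> D'"
    then obtain u where u: "e' k = Some u" by (auto simp: D'_def)
    then obtain i where "e i = Some u" "q u i = k"
      using q[of u] by (auto simp: bij_betw_def image_iff) (metis (mono_tags, lifting) imageE mem_Collect_eq)
    then show "k \<in> r ` D" by (force simp: D_def r_def)
  qed
  have bij: "bij_betw r D D'" using inj img by (simp add: bij_betw_def)
  have down: "\<And>i j. i \<le> j \<Longrightarrow> j \<in> D \<Longrightarrow> i \<in> D" "\<And>i j. i \<le> j \<Longrightarrow> j \<in> D' \<Longrightarrow> i \<in> D'"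
  proof -
    have mono: "\<forall>i j. i \<le> j \<longrightarrow> e i = None \<longrightarrow> e j = None" "\<forall>i j. i \<le> j \<longrightarrow> e' i = None \<longrightarrow> e' j = None"
      using e e' by (simp_all add: is_listing_def)
    show "i \<in> D" if "i \<le> j" "j \<in> D" for i j using mono(1)[rule_format, of i j] that by (cases "e i") (auto simp: D_def)
    show "i \<in> D'" if "i \<le> j" "j \<in> D'" for i j using mono(2)[rule_format, of i j] that by (cases "e' i") (auto simp: D'_def)
  qed
  have initial: "A = UNIV \<or> (A = {..<card A})"
    if d: "\<And>i j :: nat. i \<le> j \<Longrightarrow> j \<in> A \<Longrightarrow> i \<in> A" for A
  proof (cases "A = UNIV")
    case False
    then have ex: "\<exists>k. k \<notin> A" by auto
    define k where "k = (LEAST k. k \<notin> A)"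
    have k: "k \<notin> A" unfolding k_def using ex by (rule LeastI_ex)
    have "i \<in> A \<longleftrightarrow> i < k" for i
      using k d[of k i] not_less_Least[of i "\<lambda>k. k \<notin> A", folded k_def] by linarith
    then have "A = {..<k}" by blast
    then show ?thesis by (metis card_lessThan)
  qed simp
  have "D = D'"
  proof -
    have "finite D \<longleftrightarrow> finite D'" "card D = card D'"
      using bij bij_betw_finite bij_betw_same_card by blast+
    moreover have "D = UNIV \<or> D = {..<card D}" by (rule initial, erule (1) down(1))
    moreover have "D' = UNIV \<or> D' = {..<card D'}" by (rule initial, erule (1) down(2))
    ultimately show ?thesis
      by (metis finite_lessThan infinite_UNIV_nat)
  qed
  define p where "p i = (if i \<in> D then r i else i)" for i
  have "bij_betw p (D \<union> - D) (D \<union> - D)"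
  proof (rule bij_betw_combine)
    show "bij_betw p D D" using bij \<open>D = D'\<close> bij_betw_cong[of D p r D] by (simp add: p_def)
    show "bij_betw p (- D) (- D)" using bij_betw_cong[of "- D" p id "- D"] by (simp add: p_def)
  qed simp
  then have "bij p" by simp
  moreover have "e' (p i) = e i" for i
  proof (cases "i \<in> D")
    case False
    then have "i \<notin> D'" using \<open>D = D'\<close> by simp
    with False show ?thesis by (simp add: p_def D_def D'_def)
  qed (simp add: p_def r)
  ultimately show ?thesis by (rule that)
qed

lemma subst_listing_unique:
  fixes g :: "'v mfps"
  assumes "symmetric_mfps f" "is_listing e g" "is_listing e' g"
  shows "subst_listing f e = subst_listing f e'"
proof (rule mfps_eqI)
  fix u :: "'v multiset"
  obtain p where p: "bij p" and e': "\<And>i. e' (p i) = e i"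
    using listing_rearrange[OF assms(2,3)] by blast
  let ?A = "\<lambda>e. {a. (\<forall>i\<in>#a. e i \<noteq> None) \<and> (\<Sum>i\<in>#a. the (e i)) = u \<and> mcoeff f a \<noteq> 0}"
  have sym: "mcoeff f (image_mset s a) = mcoeff f a" if "bij s" for s a
    using assms(1) that by (simp add: symmetric_mfps_def)
  have inv: "bij (inv p)" "\<And>i. p (inv p i) = i" "\<And>i. inv p (p i) = i"
    using p by (auto simp: bij_imp_bij_inv bij_is_surj surj_f_inv_f bij_is_inj)
  have e: "e (inv p i) = e' i" for i using e'[of "inv p i"] inv(2) by simp
  show "mcoeff (subst_listing f e) u = mcoeff (subst_listing f e') u"
    unfolding mcoeff_subst_listing
    by (rule sum.reindex_bij_witness[of _ "image_mset (inv p)" "image_mset p"])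
       (auto simp: image_mset.compositionality comp_def inv sym p e e')
qed

theorem plethysm_eq:
  assumes "symmetric_mfps f" "is_listing e g"
  shows "plethysm f g = subst_listing f e"
  unfolding plethysm_def
  using subst_listing_unique[OF assms(1) someI[of "\<lambda>e. is_listing e g", OF assms(2)] assms(2)] .

lemma listing_divisors_finite:
  assumes e: "is_listing e g" and g0: "mcoeff g {#} = 0"
  shows "e i \<noteq> Some {#}"
    and "finite {a. (\<forall>i\<in>#a. e i \<noteq> None) \<and> (\<Sum>i\<in>#a. the (e i)) = u}"
    and "(\<forall>i\<in>#a. e i \<noteq> None) \<Longrightarrow> size a \<le> size (\<Sum>i\<in>#a. the (e i))"
proof -
  have ne: "e i \<noteq> Some {#}" for i
  proof -
    have "finite {i. e i = Some {#}} \<and> card {i. e i = Some {#}} = 0"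
      using e g0 unfolding is_listing_def by (metis of_nat_eq_0_iff)
    then show ?thesis by auto
  qed
  then show "e i \<noteq> Some {#}" .
  have sz: "size a \<le> size (\<Sum>i\<in>#a. the (e i))" if "\<forall>i\<in>#a. e i \<noteq> None" for a
    using that
  proof (induction a)
    case (add x a)
    then have "size (the (e x)) \<ge> 1"
      using ne[of x] by (cases "e x") (auto simp: Suc_le_eq nonempty_has_size)
    with add show ?case by simp
  qed simp
  then show "(\<forall>i\<in>#a. e i \<noteq> None) \<Longrightarrow> size a \<le> size (\<Sum>i\<in>#a. the (e i))" .
  let ?K = "\<Union>v \<in> {v. v \<subseteq># u}. {i. e i = Some v}"
  have finK: "finite ?K" using e finite_submultisets by (auto simp: is_listing_def)
  show "finite {a. (\<forall>i\<in>#a. e i \<noteq> None) \<and> (\<Sum>i\<in>#a. the (e i)) = u}"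
  proof (rule finite_subset)
    show "finite (mset ` {xs. set xs \<subseteq> ?K \<and> length xs \<le> size u})"
      by (intro finite_imageI finite_lists_length_le finK)
    show "{a. (\<forall>i\<in>#a. e i \<noteq> None) \<and> (\<Sum>i\<in>#a. the (e i)) = u}
        \<subseteq> mset ` {xs. set xs \<subseteq> ?K \<and> length xs \<le> size u}"
    proof
      fix a assume "a \<in> {a. (\<forall>i\<in>#a. e i \<noteq> None) \<and> (\<Sum>i\<in>#a. the (e i)) = u}"
      then have a: "\<forall>i\<in>#a. e i \<noteq> None" "(\<Sum>i\<in>#a. the (e i)) = u" by auto
      obtain xs where xs: "a = mset xs" by (metis ex_mset)
      have "i \<in> ?K" if "i \<in># a" for i
      proof -
        obtain a' where "a = add_mset i a'" using multi_member_split[OF \<open>i \<in># a\<close>] by blast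
        then have "the (e i) \<subseteq># u" using a(2) by auto
        moreover have "e i = Some (the (e i))" using a(1) that by auto
        ultimately show ?thesis by blast
      qed
      moreover have "size a \<le> size u" using sz[OF a(1)] a(2) by simp
      ultimately have "xs \<in> {xs. set xs \<subseteq> ?K \<and> length xs \<le> size u}" using xs by auto
      then show "a \<in> mset ` {xs. set xs \<subseteq> ?K \<and> length xs \<le> size u}" using xs by blast
    qed
  qed
qed

theorem plethysm_summable:
  assumes "is_listing e g" "mcoeff g {#} = 0"
  shows "formal_summable (\<lambda>a. of_int (mcoeff f a) * (\<Prod>i\<in>#a. listing_entry e i)) UNIV"
  unfolding formal_summable_def mcoeff_subst_term
  by (intro allI finite_subset[OF _ listing_divisors_finite(2)[OF assms]]) (auto split: if_splits)

lemma symmetric_hsym: "symmetric_mfps (hsym m)"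
  unfolding symmetric_mfps_def by transfer simp

lemma plethysm_hsym_0:
  assumes "is_listing e g" shows "plethysm (hsym 0) g = 1"
proof (rule mfps_eqI)
  fix u
  have h: "mcoeff (hsym 0) a = (if a = {#} then 1 else 0)" for a by transfer simp
  have "{a. (\<forall>i\<in>#a. e i \<noteq> None) \<and> (\<Sum>i\<in>#a. the (e i)) = u \<and> mcoeff (hsym 0) a \<noteq> 0}
      = (if u = {#} then {{#}} else {})" by (auto simp: h)
  then show "mcoeff (plethysm (hsym 0) g) u = mcoeff 1 u"
    by (simp add: plethysm_eq[OF symmetric_hsym assms] mcoeff_subst_listing mcoeff_1 h)
qed

theorem plethysm_hsym_summable:
  assumes "is_listing e g" "mcoeff g {#} = 0"
  shows "formal_summable (\<lambda>n. plethysm (hsym n) g) UNIV"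
  unfolding formal_summable_def
proof
  fix u
  have "n \<le> size u" if "mcoeff (plethysm (hsym n) g) u \<noteq> 0" for n
  proof -
    have "mcoeff (subst_listing (hsym n) e) u \<noteq> 0"
      using that plethysm_eq[OF symmetric_hsym assms(1)] by metis
    then obtain a where a: "\<forall>i\<in>#a. e i \<noteq> None" "(\<Sum>i\<in>#a. the (e i)) = u"
        and h: "mcoeff (hsym n) a \<noteq> 0"
      unfolding mcoeff_subst_listing by (rule sum.not_neutral_contains_not_neutral) blast
    from h have "size a = n" by transfer (simp split: if_splits)
    with a listing_divisors_finite(3)[OF assms a(1)] show ?thesis by simp
  qed
  then have "{n \<in> UNIV. mcoeff (plethysm (hsym n) g) u \<noteq> 0} \<subseteq> {..size u}" by auto
  then show "finite {n \<in> UNIV. mcoeff (plethysm (hsym n) g) u \<noteq> 0}"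
    by (rule finite_subset) simp
qed

lemma prod_list_mvar: "(\<Prod>i\<leftarrow>w. mvar (X i)) = monom (mset (map X w))"
  by (induction w) (simp_all add: monom_empty monom_mult)

theorem Fqs_summable: "formal_summable (\<lambda>w. \<Prod>i\<leftarrow>w. mvar (X i)) (fqs_words S n)"
  unfolding formal_summable_def
proof
  fix u
  have "{w \<in> fqs_words S n. mcoeff (\<Prod>i\<leftarrow>w. mvar (X i)) u \<noteq> 0}
      \<subseteq> {w. set w \<subseteq> X -` set_mset u \<and> length w = n}"
    by (auto simp: prod_list_mvar mcoeff_monom fqs_words_def split: if_splits)
  moreover have "finite (X -` set_mset u)" by (rule finite_vimageI) (auto intro: injI)
  ultimately show "finite {w \<in> fqs_words S n. mcoeff (\<Prod>i\<leftarrow>w. mvar (X i)) u \<noteq> 0}"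
    by (rule finite_subset[OF _ finite_lists_length_eq])
qed

lemma mcoeff_Fqs: "mcoeff (Fqs S n) u = int (card {w \<in> fqs_words S n. mset (map X w) = u})"
proof -
  have "{w \<in> fqs_words S n. mcoeff (\<Prod>i\<leftarrow>w. mvar (X i)) u \<noteq> 0} = {w \<in> fqs_words S n. mset (map X w) = u}"
    by (auto simp: prod_list_mvar mcoeff_monom)
  then show ?thesis by (simp add: Fqs_def mcoeff_formal_sum prod_list_mvar mcoeff_monom)
qed

lemma mcoeff_Fqs_nonneg: "mcoeff (Fqs S n) u \<ge> 0"
  by (simp add: mcoeff_Fqs)

lemma mcoeff_Fqs_degree: "size u \<noteq> n \<Longrightarrow> mcoeff (Fqs S n) u = 0"
  by (auto simp: mcoeff_Fqs fqs_words_def card_eq_0_iff)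

lemma mcoeff_Qlam_nonneg: "mcoeff (Qlam lam j) u \<ge> 0"
  by (simp add: Qlam_def Let_def mcoeff_sum sum_nonneg mcoeff_Fqs_nonneg)

lemma mcoeff_Qlam_degree: "size u \<noteq> sum_mset lam \<Longrightarrow> mcoeff (Qlam lam j) u = 0"
  by (simp add: Qlam_def Let_def mcoeff_sum mcoeff_Fqs_degree)

instance var :: countable
  by countable_datatype

theorem plethysm_arg1:
  assumes "i \<ge> 1"
  defines "g \<equiv> \<Sum>j=0..i-1. Qlam {#i#} j * mvar T ^ j"
  shows "\<exists>e. is_listing e g" and "mcoeff g {#} = 0"
proof -
  show "\<exists>e. is_listing e g"
    by (rule is_listing_exists)
       (auto simp: g_def mcoeff_sum mvar_power mcoeff_mult_monom mcoeff_Qlam_nonneg intro!: sum_nonneg)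
  show "mcoeff g {#} = 0" using assms(1)
    by (auto simp: g_def mcoeff_sum mvar_power mcoeff_mult_monom mcoeff_Qlam_degree intro!: sum.neutral)
qed

lemma mcoeff_times_tz:
  "mcoeff (f * mvar T ^ j * mvar Z ^ n) u =
     (if replicate_mset n Z + replicate_mset j T \<subseteq># u
      then mcoeff f (u - replicate_mset n Z - replicate_mset j T) else 0)"
proof -
  have "f * mvar T ^ j * mvar Z ^ n = f * monom (replicate_mset n Z + replicate_mset j T)"
    by (simp add: mvar_power mult.assoc monom_mult add.commute)
  then show ?thesis by (simp add: mcoeff_mult_monom diff_diff_add)
qed

theorem tz_summable: "formal_summable (\<lambda>(n, j). f n j * mvar T ^ j * mvar Z ^ n) I"
  unfolding formal_summable_def
proof
  fix u
  have "n \<le> count u Z \<and> j \<le> count u T"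
    if "mcoeff (f n j * mvar T ^ j * mvar Z ^ n) u \<noteq> 0" for n j
  proof -
    have le: "replicate_mset n Z + replicate_mset j T \<subseteq># u"
      using that by (simp add: mcoeff_times_tz split: if_splits)
    show ?thesis
      using mset_subset_eq_count[OF le, of Z] mset_subset_eq_count[OF le, of T] by simp
  qed
  then have "{i \<in> I. mcoeff (case i of (n, j) \<Rightarrow> f n j * mvar T ^ j * mvar Z ^ n) u \<noteq> 0}
      \<subseteq> {..count u Z} \<times> {..count u T}" by auto
  then show "finite {i \<in> I. mcoeff (case i of (n, j) \<Rightarrow> f n j * mvar T ^ j * mvar Z ^ n) u \<noteq> 0}"
    by (rule finite_subset) simp
qed

theorem plethysm_arg2:
  defines "g \<equiv> formal_sum (\<lambda>(i, j). Qlam {#i#} j * mvar T ^ j * mvar Z ^ i) ({1..} \<times> UNIV)"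
  shows "\<exists>e. is_listing e g" and "mcoeff g {#} = 0"
proof -
  show "\<exists>e. is_listing e g"
    by (rule is_listing_exists)
       (auto simp: g_def mcoeff_formal_sum mcoeff_times_tz mcoeff_Qlam_nonneg intro!: sum_nonneg)
  show "mcoeff g {#} = 0"
    by (auto simp: g_def mcoeff_formal_sum mcoeff_times_tz intro!: sum.neutral)
qed

end

theory Submission
  imports Defs "HOL-Library.Product_Lexorder"
begin

text \<open>
  The coefficients of \<open>\<Sum>\<^sub>j Q\<^bsub>\<lambda>,j\<^esub> t\<^sup>j\<close> count pairs \<open>(\<sigma>, w)\<close> of a permutation and a weakly
  decreasing word that drops at every element of \<open>DEX \<sigma>\<close> (\<open>configs\<close>). The theorem says that such a
  pair is the same thing as an arbitrary multiset of pairs whose permutation is a single cycle. The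
  bijection is a variant of the one of Gessel and Reutenauer.

  Give position \<open>i\<close> a bead: the letter \<open>w\<^sub>i\<close>, coloured red if \<open>i\<close> is an excedance and blue
  otherwise. Order beads so that larger letters come first and, for equal letters, red comes before
  blue. The condition on \<open>w\<close> then says precisely that the pairs (bead of \<open>i\<close>, \<open>\<sigma> i\<close>) increase
  lexicographically with \<open>i\<close> (\<open>fqs_words_DEX_iff\<close>). Let the code of \<open>i\<close> be the infinite sequence of
  the beads of \<open>i, \<sigma> i, \<sigma>\<^sup>2 i, \<dots>\<close>. Iterating the condition shows that positions are sorted by their
  codes. This has two consequences. Distinct positions on one cycle have distinct codes, so a cycle
  becomes an orbit of the shift on codes, of the same size: a primitive necklace. And \<open>i\<close> is an
  excedance if and only if the code of \<open>i\<close> is smaller than its shift, which is a condition on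
  necklaces alone.

  So \<open>(\<sigma>, w)\<close> yields a multiset of necklaces (an ornament) whose sizes form the cycle type. It can be
  recovered: sorting all codes of the ornament tells which position has which code, hence all
  beads, and positions with equal codes are mapped by \<open>\<sigma>\<close> in increasing order
  (\<open>necklaces_of_inj\<close>). The same recipe turns every multiset of necklaces into a pair
  (\<open>necklaces_of_surj\<close>), which gives the bijection \<open>necklaces_of_bij\<close>.

  It remains to compare generating functions. If \<open>g\<close> enumerates a weighted set, then \<open>h\<^sub>m[g]\<close>
  enumerates the multisets of size \<open>m\<close> over it (\<open>plethysm_hsym_gen_fun\<close>). Single cycles correspond to
  single necklaces, so \<open>h\<^bsub>m\<^esub>[\<Sum>\<^sub>j Q\<^bsub>(i),j\<^esub> t\<^sup>j]\<close> enumerates multisets of \<open>m\<close> necklaces of size \<open>i\<close>, and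
  the product over \<open>i\<close> enumerates ornaments of type \<open>\<lambda>\<close>. The second identity enumerates all
  multisets of necklaces at once, \<open>z\<close> recording the number of beads.
\<close>

section \<open>Generating functions of weighted sets\<close>

lift_definition gen_fun :: "'a set \<Rightarrow> ('a \<Rightarrow> 'v multiset) \<Rightarrow> 'v mfps" is
  "\<lambda>A wt u. int (card {a \<in> A. wt a = u})" .

definition finite_fibres :: "'a set \<Rightarrow> ('a \<Rightarrow> 'v multiset) \<Rightarrow> bool" where
  "finite_fibres A wt \<longleftrightarrow> (\<forall>u. finite {a \<in> A. wt a = u})"

lemma mcoeff_gen_fun: "mcoeff (gen_fun A wt) u = int (card {a \<in> A. wt a = u})"
  by transfer simp

lemma gen_fun_bij:
  assumes "bij_betw f A B" "\<And>a. a \<in> A \<Longrightarrow> wt' (f a) = wt a"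
  shows "gen_fun A wt = gen_fun B wt'"
proof (rule mfps_eqI)
  fix u
  have "bij_betw f {a \<in> A. wt a = u} {b \<in> B. wt' b = u}"
    using assms by (auto intro!: bij_betw_Collect)
  then show "mcoeff (gen_fun A wt) u = mcoeff (gen_fun B wt') u"
    by (simp add: mcoeff_gen_fun bij_betw_same_card)
qed

lemma finite_fibres_bij:
  assumes "bij_betw f A B" "\<And>a. a \<in> A \<Longrightarrow> wt' (f a) = wt a"
  shows "finite_fibres A wt \<longleftrightarrow> finite_fibres B wt'"
proof -
  have "finite {a \<in> A. wt a = u} \<longleftrightarrow> finite {b \<in> B. wt' b = u}" for u
    by (rule bij_betw_finite[of f], rule bij_betw_Collect[OF assms(1)]) (simp add: assms(2))
  then show ?thesis by (simp add: finite_fibres_def)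
qed

lemma finite_fibres_subset:
  assumes "finite_fibres B wt" "A \<subseteq> B"
  shows "finite_fibres A wt"
  unfolding finite_fibres_def
proof
  fix u
  have "{a \<in> A. wt a = u} \<subseteq> {a \<in> B. wt a = u}" using assms(2) by blast
  then show "finite {a \<in> A. wt a = u}"
    using assms(1) finite_subset unfolding finite_fibres_def by blast
qed

text \<open>
  A monomial has finite fibre in the union, so only finitely many of the disjoint \<open>A i\<close> contribute to
  its coefficient.
\<close>

lemma formal_sum_gen_fun:
  assumes "finite_fibres (\<Union>i\<in>I. A i) wt" "disjoint_family_on A I"
  shows "formal_sum (\<lambda>i. gen_fun (A i) wt) I = gen_fun (\<Union>i\<in>I. A i) wt"
proof (rule mfps_eqI)
  fix u
  let ?F = "\<lambda>i. {a \<in> A i. wt a = u}"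
  let ?J = "{i \<in> I. mcoeff (gen_fun (A i) wt) u \<noteq> 0}"
  have un: "(\<Union>i\<in>I. ?F i) = {a \<in> (\<Union>i\<in>I. A i). wt a = u}" by blast
  have fin: "finite (\<Union>i\<in>I. ?F i)"
    unfolding un using assms(1) by (simp add: finite_fibres_def)
  have finF: "finite (?F i)" if "i \<in> I" for i
    using that by (intro finite_subset[OF _ fin]) auto
  have J: "?J = {i \<in> I. ?F i \<noteq> {}}"
    using finF by (auto simp: mcoeff_gen_fun card_eq_0_iff)
  have disj: "?F i \<inter> ?F j = {}" if "i \<in> I" "j \<in> I" "i \<noteq> j" for i j
    using assms(2) that unfolding disjoint_family_on_def by blast
  have "finite ?J"
  proof (rule inj_on_finite)
    show "inj_on ?F ?J" unfolding J inj_on_def using disj by blast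
    show "?F ` ?J \<subseteq> Pow (\<Union>i\<in>I. ?F i)" by blast
    show "finite (Pow (\<Union>i\<in>I. ?F i))" using fin by simp
  qed
  then have "card (\<Union>i\<in>?J. ?F i) = (\<Sum>i\<in>?J. card (?F i))"
    by (rule card_UN_disjoint) (use finF disj in auto)
  moreover have "(\<Union>i\<in>?J. ?F i) = {a \<in> (\<Union>i\<in>I. A i). wt a = u}"
    unfolding J by blast
  ultimately show "mcoeff (formal_sum (\<lambda>i. gen_fun (A i) wt) I) u = mcoeff (gen_fun (\<Union>i\<in>I. A i) wt) u"
    by (simp add: mcoeff_formal_sum) (simp add: mcoeff_gen_fun)
qed

lemma sum_gen_fun_Sigma:
  assumes "finite B" "\<And>b. b \<in> B \<Longrightarrow> finite_fibres (A b) (wt b)"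
  shows "(\<Sum>b\<in>B. gen_fun (A b) (wt b)) = gen_fun (Sigma B A) (\<lambda>(b, a). wt b a)"
proof (rule mfps_eqI)
  fix u
  have "{z \<in> Sigma B A. (\<lambda>(b, a). wt b a) z = u} = (SIGMA b:B. {a \<in> A b. wt b a = u})" by auto
  then show "mcoeff (\<Sum>b\<in>B. gen_fun (A b) (wt b)) u
      = mcoeff (gen_fun (Sigma B A) (\<lambda>(b, a). wt b a)) u"
    using assms by (simp add: mcoeff_sum mcoeff_gen_fun finite_fibres_def)
qed

lemma gen_fun_times_monom: "gen_fun A wt * monom v = gen_fun A (\<lambda>a. wt a + v)"
proof (rule mfps_eqI)
  fix u
  have "{a \<in> A. wt a + v = u} = (if v \<subseteq># u then {a \<in> A. wt a = u - v} else {})" by auto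
  then show "mcoeff (gen_fun A wt * monom v) u = mcoeff (gen_fun A (\<lambda>a. wt a + v)) u"
    by (simp add: mcoeff_mult_monom mcoeff_gen_fun)
qed

lemma mcoeff_times: "mcoeff (f * g) u = (\<Sum>(a, b) | a + b = u. mcoeff f a * mcoeff g b)"
  by transfer simp

lemma gen_fun_times:
  fixes wt :: "'a \<Rightarrow> 'v multiset" and wt' :: "'b \<Rightarrow> 'v multiset"
  assumes "finite_fibres A wt" "finite_fibres B wt'"
  shows "gen_fun A wt * gen_fun B wt' = gen_fun (A \<times> B) (\<lambda>(a, b). wt a + wt' b)"
proof (rule mfps_eqI)
  fix u :: "'v multiset"
  let ?S = "{(v, w). v + w = u}"
  let ?F = "\<lambda>(v, w). {a \<in> A. wt a = v} \<times> {b \<in> B. wt' b = w}"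
  have "{z \<in> A \<times> B. (\<lambda>(a, b). wt a + wt' b) z = u} = (\<Union>p\<in>?S. ?F p)" by auto
  moreover have "card (\<Union>p\<in>?S. ?F p) = (\<Sum>p\<in>?S. card (?F p))"
    by (rule card_UN_disjoint)
       (use assms in \<open>auto simp: finite_monomial_splits finite_fibres_def\<close>)
  ultimately show "mcoeff (gen_fun A wt * gen_fun B wt') u
      = mcoeff (gen_fun (A \<times> B) (\<lambda>(a, b). wt a + wt' b)) u"
    by (simp add: mcoeff_times mcoeff_gen_fun case_prod_unfold card_cartesian_product)
qed

text \<open>
  A listing of the monomials of \<open>gen_fun A wt\<close> is, fibre by fibre, an enumeration of \<open>A\<close>. Since
  \<open>hsym m\<close> is the sum of all monomials of degree \<open>m\<close>, that is of all multisets of \<open>m\<close> indices,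
  substituting the listing sums over the multisets of \<open>m\<close> elements of \<open>A\<close>.
\<close>

lemma plethysm_hsym_gen_fun:
  fixes wt :: "'a \<Rightarrow> 'v :: countable multiset"
  assumes fin: "finite_fibres A wt"
  shows "plethysm (hsym m) (gen_fun A wt) =
    gen_fun {M. set_mset M \<subseteq> A \<and> size M = m} (\<lambda>M. \<Sum>a\<in>#M. wt a)"
proof -
  obtain e where e: "is_listing e (gen_fun A wt)"
    using is_listing_exists[of "gen_fun A wt"] by (auto simp: mcoeff_gen_fun)
  define D where "D = {i. e i \<noteq> None}"
  have "\<exists>b. bij_betw b {i. e i = Some u} {a \<in> A. wt a = u}" for u
    using e fin by (intro finite_same_card_bij)
      (auto simp: is_listing_def mcoeff_gen_fun finite_fibres_def)
  then obtain b where b: "\<And>u. bij_betw (b u) {i. e i = Some u} {a \<in> A. wt a = u}" by metis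
  define \<beta> where "\<beta> i = b (the (e i)) i" for i
  have \<beta>: "\<beta> i \<in> A" "wt (\<beta> i) = the (e i)" if "i \<in> D" for i
    using that b[of "the (e i)"] by (auto simp: D_def \<beta>_def bij_betw_def)
  \<comment> \<open>Gluing the fibrewise bijections identifies the used indices of the listing with \<open>A\<close>.\<close>
  have bij: "bij_betw \<beta> D A"
  proof (rule bij_betwI')
    show "\<beta> i = \<beta> j \<longleftrightarrow> i = j" if "i \<in> D" "j \<in> D" for i j
    proof
      assume eq: "\<beta> i = \<beta> j"
      then have "e i = e j" using \<beta>(2)[OF that(1)] \<beta>(2)[OF that(2)] that by (auto simp: D_def)
      with eq show "i = j" using that b[of "the (e i)"]
        by (auto simp: D_def \<beta>_def bij_betw_def inj_on_def)
    qed simp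
    show "\<beta> i \<in> A" if "i \<in> D" for i using \<beta> that by blast
    show "\<exists>i\<in>D. a = \<beta> i" if "a \<in> A" for a
    proof -
      have "a \<in> b (wt a) ` {i. e i = Some (wt a)}"
        using b[of "wt a"] that by (simp add: bij_betw_def)
      then obtain i where "e i = Some (wt a)" "a = b (wt a) i" by blast
      then show ?thesis by (auto simp: D_def \<beta>_def)
    qed
  qed
  have hs: "mcoeff (hsym m) a = (if size a = m then 1 else 0)" for a by transfer simp
  have "mcoeff (subst_listing (hsym m) e) u
      = mcoeff (gen_fun {M. set_mset M \<subseteq> A \<and> size M = m} (\<lambda>M. \<Sum>a\<in>#M. wt a)) u" for u
  proof -
    let ?P = "{a. (\<forall>i\<in>#a. e i \<noteq> None) \<and> (\<Sum>i\<in>#a. the (e i)) = u \<and> mcoeff (hsym m) a \<noteq> 0}"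
    let ?Q = "{M \<in> {M. set_mset M \<subseteq> A \<and> size M = m}. (\<Sum>a\<in>#M. wt a) = u}"
    have sumeq: "(\<Sum>i\<in>#a. wt (\<beta> i)) = (\<Sum>i\<in>#a. the (e i))" if "set_mset a \<subseteq> D" for a
      using that \<beta> by (intro arg_cong[of _ _ sum_mset] image_mset_cong) auto
    have "bij_betw (image_mset \<beta>) ?P ?Q"
    proof (rule bij_betw_byWitness[where f' = "image_mset (inv_into D \<beta>)"])
      have inv: "inv_into D \<beta> x \<in> D" "\<beta> (inv_into D \<beta> x) = x" if "x \<in> A" for x
        using that bij by (auto simp: bij_betw_def f_inv_into_f inv_into_into)
      have inv2: "inv_into D \<beta> (\<beta> i) = i" if "i \<in> D" for i
        using that bij by (auto simp: bij_betw_def)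
      show "\<forall>a\<in>?P. image_mset (inv_into D \<beta>) (image_mset \<beta> a) = a"
      proof
        fix a assume "a \<in> ?P"
        then have "inv_into D \<beta> (\<beta> i) = i" if "i \<in># a" for i
          using that by (intro inv2) (auto simp: D_def)
        then show "image_mset (inv_into D \<beta>) (image_mset \<beta> a) = a"
          by (simp add: image_mset.compositionality comp_def cong: image_mset_cong)
      qed
      show "\<forall>M\<in>?Q. image_mset \<beta> (image_mset (inv_into D \<beta>) M) = M"
        by (auto simp: image_mset.compositionality comp_def inv subset_iff intro!: trans[OF image_mset_cong multiset.map_ident])
      show "image_mset \<beta> ` ?P \<subseteq> ?Q"
        using \<beta>(1) sumeq by (fastforce simp: hs image_mset.compositionality comp_def D_def split: if_splits)
      show "image_mset (inv_into D \<beta>) ` ?Q \<subseteq> ?P"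
      proof
        fix a assume "a \<in> image_mset (inv_into D \<beta>) ` ?Q"
        then obtain M where a: "a = image_mset (inv_into D \<beta>) M"
          and M: "set_mset M \<subseteq> A" "size M = m" "(\<Sum>a\<in>#M. wt a) = u" by blast
        then have sub: "set_mset (image_mset (inv_into D \<beta>) M) \<subseteq> D" using inv(1) by auto
        have "(\<Sum>i\<in>#image_mset (inv_into D \<beta>) M. the (e i))
            = (\<Sum>a\<in>#M. wt (\<beta> (inv_into D \<beta> a)))"
          using sumeq[OF sub] by (simp add: image_mset.compositionality comp_def)
        also have "\<dots> = (\<Sum>a\<in>#M. wt a)"
          using M(1) inv by (intro arg_cong[of _ _ sum_mset] image_mset_cong) auto
        finally have "(\<Sum>i\<in>#a. the (e i)) = u" using a M(3) by simp
        then show "a \<in> ?P" using sub a M(2) by (auto simp: hs D_def)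
      qed
    qed
    then have "card ?P = card ?Q" by (rule bij_betw_same_card)
    moreover have "(\<Sum>a\<in>?P. mcoeff (hsym m) a) = (\<Sum>a\<in>?P. 1)"
      by (intro sum.cong) (auto simp: hs split: if_splits)
    ultimately show ?thesis by (simp add: mcoeff_subst_listing mcoeff_gen_fun)
  qed
  then show ?thesis by (simp add: plethysm_eq[OF symmetric_hsym e] mfps_eqI)
qed

section \<open>Beads and codes\<close>

datatype bead = Red nat | Blue nat

text \<open>
  The key puts larger letters first and, among beads with the same letter, the red one before the
  blue one. Smaller letters come later because the words \<open>w\<close> are weakly decreasing; red comes first
  because barred letters precede unbarred ones.
\<close>

fun bead_key :: "bead \<Rightarrow> int" where
  "bead_key (Red a) = - 2 * int a - 1"
| "bead_key (Blue a) = - 2 * int a"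

lemma bead_key_inj: "bead_key x = bead_key y \<Longrightarrow> x = y"
  by (cases x; cases y) (simp_all, presburger+)

instantiation bead :: linorder
begin

definition less_eq_bead :: "bead \<Rightarrow> bead \<Rightarrow> bool" where
  "x \<le> y \<longleftrightarrow> bead_key x \<le> bead_key y"

definition less_bead :: "bead \<Rightarrow> bead \<Rightarrow> bool" where
  "x < y \<longleftrightarrow> bead_key x < bead_key y"

instance
  by standard (auto simp: less_eq_bead_def less_bead_def dest: bead_key_inj)

end

lemma bead_less_simps [simp]:
  "Red a < Red b \<longleftrightarrow> b < a" "Blue a < Blue b \<longleftrightarrow> b < a"
  "Red a < Blue b \<longleftrightarrow> b \<le> a" "Blue a < Red b \<longleftrightarrow> b < a"
  by (auto simp: less_bead_def)

fun bead_colour :: "bead \<Rightarrow> bool" where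
  "bead_colour (Red a) = True" | "bead_colour (Blue a) = False"

fun bead_value :: "bead \<Rightarrow> nat" where
  "bead_value (Red a) = a" | "bead_value (Blue a) = a"

text \<open>
  A code is an infinite sequence of beads. It is a type of its own so that it can carry the
  lexicographic order.
\<close>

datatype code = Code (bead_at: "nat \<Rightarrow> bead")

definition head :: "code \<Rightarrow> bead" where "head c = bead_at c 0"

definition shift :: "code \<Rightarrow> code" where "shift c = Code (\<lambda>k. bead_at c (Suc k))"

instantiation code :: linorder
begin

definition less_code :: "code \<Rightarrow> code \<Rightarrow> bool" where
  "c < d \<longleftrightarrow> (\<exists>k. (\<forall>j<k. bead_at c j = bead_at d j) \<and> bead_at c k < bead_at d k)"

definition less_eq_code :: "code \<Rightarrow> code \<Rightarrow> bool" where
  "c \<le> d \<longleftrightarrow> c < d \<or> c = (d :: code)"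

instance
proof
  fix c d e :: code
  have irrefl: "\<not> c < c" for c :: code by (simp add: less_code_def)
  have trans: "c < e" if "c < d" "d < e" for c d e :: code
  proof -
    from that obtain k l where k: "\<forall>j<k. bead_at c j = bead_at d j" "bead_at c k < bead_at d k"
      and l: "\<forall>j<l. bead_at d j = bead_at e j" "bead_at d l < bead_at e l"
      unfolding less_code_def by blast
    show ?thesis
      unfolding less_code_def
    proof (intro exI conjI)
      show "\<forall>j<min k l. bead_at c j = bead_at e j" using k(1) l(1) by simp
      show "bead_at c (min k l) < bead_at e (min k l)"
        using k l by (cases k l rule: linorder_cases) auto
    qed
  qed
  show "c < d \<longleftrightarrow> c \<le> d \<and> \<not> d \<le> c" using irrefl trans by (auto simp: less_eq_code_def)
  show "c \<le> c" by (simp add: less_eq_code_def)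
  show "c \<le> d \<Longrightarrow> d \<le> e \<Longrightarrow> c \<le> e" using trans by (auto simp: less_eq_code_def)
  show "c \<le> d \<Longrightarrow> d \<le> c \<Longrightarrow> c = d" using irrefl trans by (auto simp: less_eq_code_def)
  show "c \<le> d \<or> d \<le> c"
  proof (cases "c = d")
    case False
    then have ex: "\<exists>k. bead_at c k \<noteq> bead_at d k" by (metis code.expand ext)
    define k where "k = (LEAST k. bead_at c k \<noteq> bead_at d k)"
    have "bead_at c k \<noteq> bead_at d k" unfolding k_def using ex by (rule LeastI_ex)
    moreover have "\<forall>j<k. bead_at c j = bead_at d j" unfolding k_def using not_less_Least by blast
    ultimately show ?thesis unfolding less_eq_code_def less_code_def by (metis linorder_neqE)
  qed (simp add: less_eq_code_def)
qed

end

lemma shift_less_iff: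
  assumes "head c = head d"
  shows "shift c < shift d \<longleftrightarrow> c < d"
proof
  assume "shift c < shift d"
  then obtain k where k: "\<forall>j<k. bead_at c (Suc j) = bead_at d (Suc j)"
      "bead_at c (Suc k) < bead_at d (Suc k)"
    unfolding less_code_def shift_def by auto
  then have "\<forall>j<Suc k. bead_at c j = bead_at d j"
    using assms by (simp add: All_less_Suc2 head_def)
  with k(2) show "c < d" unfolding less_code_def by blast
next
  assume "c < d"
  then obtain k where k: "\<forall>j<k. bead_at c j = bead_at d j" "bead_at c k < bead_at d k"
    unfolding less_code_def by blast
  then obtain l where "k = Suc l" using assms by (cases k) (auto simp: head_def)
  with k show "shift c < shift d" unfolding less_code_def shift_def by auto
qed

lemma head_less_imp_less: "head c < head d \<Longrightarrow> c < d"
  unfolding less_code_def head_def by auto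

lemma head_mono: "c \<le> d \<Longrightarrow> head c \<le> head d"
  using head_less_imp_less[of d c] by (metis leD leI)

lemma head_funpow_shift: "head ((shift ^^ k) c) = bead_at c k"
  by (induction k arbitrary: c) (simp_all add: head_def shift_def funpow_swap1 del: funpow.simps(2) add: funpow_simps_right)

text \<open>
  The shift forgets the first bead, but on periodic codes it is invertible: \<open>c\<close> lies in the finite
  orbit of \<open>shift c\<close>, and the shift permutes that orbit.
\<close>

lemma shift_inj_periodic:
  assumes "c \<in> orbit shift c" "d \<in> orbit shift d" "shift c = shift d"
  shows "c = d"
proof -
  have c: "orbit shift c = orbit shift (shift c)" "orbit shift d = orbit shift (shift c)"
    using assms by (metis self_in_orbit_step)+
  then have fin: "finite (orbit shift (shift c))" using finite_orbit[OF assms(1)] by simp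
  have "shift ` orbit shift (shift c) = orbit shift (shift c)"
    using orbit_inverse[of c shift shift shift] c assms(1) by simp
  then have "inj_on shift (orbit shift (shift c))" using fin by (simp add: eq_card_imp_inj_on)
  then show ?thesis using assms c by (metis inj_onD)
qed

definition itinerary :: "('a \<Rightarrow> 'a) \<Rightarrow> ('a \<Rightarrow> bead) \<Rightarrow> 'a \<Rightarrow> code" where
  "itinerary \<sigma> b x = Code (\<lambda>k. b ((\<sigma> ^^ k) x))"

lemma head_itinerary [simp]: "head (itinerary \<sigma> b x) = b x"
  by (simp add: head_def itinerary_def)

lemma shift_itinerary: "shift (itinerary \<sigma> b x) = itinerary \<sigma> b (\<sigma> x)"
  by (simp add: shift_def itinerary_def funpow_swap1)

text \<open>
  While the beads along the two orbits agree, the hypothesis keeps the two points in the same order;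
  so at the first place where the beads differ, the orbit of \<open>x\<close> has the smaller one.
\<close>

lemma itinerary_mono:
  fixes \<sigma> :: "'a :: linorder \<Rightarrow> 'a"
  assumes mono: "strict_mono_on A (\<lambda>x. (b x, \<sigma> x))" and closed: "\<sigma> ` A \<subseteq> A"
    and xy: "x \<in> A" "y \<in> A" "x < y"
  shows "itinerary \<sigma> b x \<le> itinerary \<sigma> b y"
proof (rule ccontr)
  assume "\<not> ?thesis"
  then have "itinerary \<sigma> b y < itinerary \<sigma> b x" by simp
  then obtain k where eq: "\<And>j. j < k \<Longrightarrow> b ((\<sigma> ^^ j) y) = b ((\<sigma> ^^ j) x)"
      and less: "b ((\<sigma> ^^ k) y) < b ((\<sigma> ^^ k) x)"
    unfolding less_code_def itinerary_def by auto
  have step: "b u < b v \<or> b u = b v \<and> \<sigma> u < \<sigma> v" if "u \<in> A" "v \<in> A" "u < v" for u v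
    using strict_mono_onD[OF mono that] by (auto simp: less_prod_def')
  have "(\<sigma> ^^ j) x \<in> A \<and> (\<sigma> ^^ j) y \<in> A \<and> (\<sigma> ^^ j) x < (\<sigma> ^^ j) y" if "j \<le> k" for j
    using that
  proof (induction j)
    case (Suc j)
    then show ?case using step[of "(\<sigma> ^^ j) x" "(\<sigma> ^^ j) y"] eq[of j] closed by auto
  qed (use xy in auto)
  from step[of "(\<sigma> ^^ k) x" "(\<sigma> ^^ k) y"] this[of k] less show False by auto
qed

lemma equal_beads_keep_order:
  fixes \<sigma> :: "'a :: linorder \<Rightarrow> 'a" and b :: "'a \<Rightarrow> bead"
  assumes mono: "strict_mono_on A (\<lambda>x. (b x, \<sigma> x))"
    and xy: "x \<in> A" "y \<in> A" "x < y" and eq: "b x = b y"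
  shows "\<sigma> x < \<sigma> y"
  using strict_mono_onD[OF mono xy] eq by (simp add: less_prod_def')

text \<open>
  Points with equal codes keep their order under \<open>\<sigma>\<close>. If \<open>y = \<sigma>\<^sup>m x\<close> lies above \<open>x\<close> with the same code,
  then iterating \<open>\<sigma>\<^sup>m\<close> would climb forever inside a finite set. This is why the cycles of \<open>\<sigma>\<close> give
  primitive necklaces.
\<close>

lemma itinerary_not_eq_above:
  fixes \<sigma> :: "'a :: linorder \<Rightarrow> 'a"
  assumes mono: "strict_mono_on A (\<lambda>x. (b x, \<sigma> x))" and closed: "\<sigma> ` A \<subseteq> A" and fin: "finite A"
    and x: "x \<in> A" and y: "y \<in> orbit \<sigma> x" and less: "x < y"
    and eq: "itinerary \<sigma> b x = itinerary \<sigma> b y"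
  shows False
proof -
  from y obtain m where m: "y = (\<sigma> ^^ m) x" by (auto simp: orbit_altdef)
  let ?c = "itinerary \<sigma> b"
  let ?\<tau> = "\<sigma> ^^ m"
  have push: "(\<sigma> ^^ k) u \<in> A \<and> (\<sigma> ^^ k) v \<in> A \<and> (\<sigma> ^^ k) u < (\<sigma> ^^ k) v
      \<and> ?c ((\<sigma> ^^ k) u) = ?c ((\<sigma> ^^ k) v)"
    if "u \<in> A" "v \<in> A" "u < v" "?c u = ?c v" for u v k
  proof (induction k)
    case (Suc k)
    have "b ((\<sigma> ^^ k) u) = b ((\<sigma> ^^ k) v)" using Suc by (metis head_itinerary)
    then show ?case using Suc closed equal_beads_keep_order[OF mono, of "(\<sigma> ^^ k) u" "(\<sigma> ^^ k) v"]
      by (auto simp: shift_itinerary[symmetric])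
  qed (use that in auto)
  have yA: "y \<in> A" unfolding m by (induction m) (use x closed in auto)
  have inc: "(?\<tau> ^^ j) x \<in> A \<and> (?\<tau> ^^ Suc j) x \<in> A \<and> (?\<tau> ^^ j) x < (?\<tau> ^^ Suc j) x
      \<and> ?c ((?\<tau> ^^ j) x) = ?c ((?\<tau> ^^ Suc j) x)" for j
  proof (induction j)
    case 0 show ?case using x yA less eq m by simp
  next
    case (Suc j)
    then show ?case using push[of "(?\<tau> ^^ j) x" "(?\<tau> ^^ Suc j) x" m] by simp
  qed
  then have "strict_mono (\<lambda>j. (?\<tau> ^^ j) x)" by (simp add: strict_mono_Suc_iff)
  then have "infinite (range (\<lambda>j. (?\<tau> ^^ j) x))"
    using range_inj_infinite strict_mono_imp_inj_on by blast
  moreover have "range (\<lambda>j. (?\<tau> ^^ j) x) \<subseteq> A" using inc by blast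
  ultimately show False using fin finite_subset by blast
qed

section \<open>Permutations with compatible words\<close>

definition bead_of :: "(nat \<Rightarrow> nat) \<Rightarrow> nat list \<Rightarrow> nat \<Rightarrow> bead" where
  "bead_of \<sigma> w i = (if i < \<sigma> i then Red (w ! (i - 1)) else Blue (w ! (i - 1)))"

lemma strict_mono_on_atLeastAtMost_iff:
  fixes f :: "nat \<Rightarrow> 'a :: order"
  shows "strict_mono_on {a..b} f \<longleftrightarrow> (\<forall>i\<in>{a..<b}. f i < f (Suc i))"
proof (intro iffI ballI)
  fix i assume "strict_mono_on {a..b} f" "i \<in> {a..<b}"
  then show "f i < f (Suc i)" by (intro strict_mono_onD[of "{a..b}" f]) auto
next
  assume step: "\<forall>i\<in>{a..<b}. f i < f (Suc i)"
  show "strict_mono_on {a..b} f"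
  proof (rule strict_mono_onI)
    fix i j assume ij: "i \<in> {a..b}" "j \<in> {a..b}" "i < j"
    from \<open>i < j\<close> have "a \<le> i \<longrightarrow> j \<le> b \<longrightarrow> f i < f j"
      by (induction rule: less_Suc_induct) (use step in \<open>auto intro: order.strict_trans\<close>)
    with ij show "f i < f j" by simp
  qed
qed

text \<open>
  This replaces the descent set \<open>DEX\<close> by an order condition between any two positions. It suffices to
  compare neighbours, where both conditions say: the letter does not increase, and if it stays the
  same, then the barred word does not descend.
\<close>

lemma fqs_words_DEX_iff:
  assumes \<sigma>: "\<sigma> permutes {1..n}"
  shows "w \<in> fqs_words (DEX n \<sigma>) n \<longleftrightarrow>
    length w = n \<and> strict_mono_on {1..n} (\<lambda>i. (bead_of \<sigma> w i, \<sigma> i))"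
proof (cases "length w = n")
  case True
  have "(bead_of \<sigma> w i, \<sigma> i) < (bead_of \<sigma> w (Suc i), \<sigma> (Suc i)) \<longleftrightarrow>
      w ! i \<le> w ! (i - 1) \<and> (i \<in> DEX n \<sigma> \<longrightarrow> w ! i < w ! (i - 1))" if i: "i \<in> {1..<n}" for i
  proof -
    have "\<sigma> i \<noteq> \<sigma> (Suc i)" using permutes_inj[OF \<sigma>] by (metis injD n_not_Suc_n)
    moreover have "Suc i \<in> EXC n \<sigma> \<longleftrightarrow> Suc i < \<sigma> (Suc i)"
      using i permutes_in_image[OF \<sigma>, of "Suc i"] by (auto simp: EXC_def)
    moreover have "i \<in> EXC n \<sigma> \<longleftrightarrow> i < \<sigma> i" using i by (auto simp: EXC_def)
    moreover have "i \<in> {1..n-1}" using i by auto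
    ultimately show ?thesis
      by (auto simp: DEX_def bar_word_def bead_of_def less_prod_def')
  qed
  then have "strict_mono_on {1..n} (\<lambda>i. (bead_of \<sigma> w i, \<sigma> i)) \<longleftrightarrow>
      (\<forall>i\<in>{1..<n}. w ! i \<le> w ! (i - 1)) \<and> (\<forall>i\<in>{1..<n}. i \<in> DEX n \<sigma> \<longrightarrow> w ! i < w ! (i - 1))"
    unfolding strict_mono_on_atLeastAtMost_iff by blast
  moreover have "(\<forall>i\<in>{1..<n}. i \<in> DEX n \<sigma> \<longrightarrow> w ! i < w ! (i - 1)) \<longleftrightarrow> (\<forall>i\<in>DEX n \<sigma>. w ! i < w ! (i - 1))"
    by (auto simp: DEX_def)
  moreover have "(\<forall>i\<in>{1..<n}. w ! i \<le> w ! (i - 1)) \<longleftrightarrow> sorted_wrt (\<ge>) w"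
  proof -
    have "(\<forall>i\<in>{1..<n}. w ! i \<le> w ! (i - 1)) \<longleftrightarrow> (\<forall>i. Suc i < n \<longrightarrow> w ! Suc i \<le> w ! i)"
    proof (intro iffI ballI allI impI)
      fix i assume "\<forall>i. Suc i < n \<longrightarrow> w ! Suc i \<le> w ! i" "i \<in> {1..<n}"
      then show "w ! i \<le> w ! (i - 1)" by (cases i) auto
    next
      fix i assume "\<forall>i\<in>{1..<n}. w ! i \<le> w ! (i - 1)" "Suc i < n"
      then show "w ! Suc i \<le> w ! i" by (auto dest: bspec[of _ _ "Suc i"])
    qed
    then show ?thesis by (simp add: sorted_wrt_iff_nth_Suc_transp transp_on_ge True)
  qed
  ultimately show ?thesis using True by (simp add: fqs_words_def)
qed (simp add: fqs_words_def)

definition configs :: "((nat \<Rightarrow> nat) \<times> nat list) set" where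
  "configs = {(\<sigma>, w). \<sigma> permutes {1..length w} \<and> w \<in> fqs_words (DEX (length w) \<sigma>) (length w)}"

lemma configs_iff:
  "(\<sigma>, w) \<in> configs \<longleftrightarrow>
    \<sigma> permutes {1..length w} \<and> strict_mono_on {1..length w} (\<lambda>i. (bead_of \<sigma> w i, \<sigma> i))"
  using fqs_words_DEX_iff by (auto simp: configs_def)

abbreviation code_of :: "(nat \<Rightarrow> nat) \<Rightarrow> nat list \<Rightarrow> nat \<Rightarrow> code" where
  "code_of \<sigma> w \<equiv> itinerary \<sigma> (bead_of \<sigma> w)"

section \<open>Necklaces\<close>

text \<open>
  The condition \<open>c \<in> orbit shift c\<close> says that \<open>c\<close> is periodic, so necklaces are finite. The condition on
  colours is what excedances become: the bead at \<open>x\<close> is red if and only if \<open>\<sigma>\<close> moves \<open>x\<close> upwards, that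
  is to a larger code. Necklaces are sets of codes, which makes them primitive.
\<close>

definition necklaces :: "code set set" where
  "necklaces = {orbit shift c | c. c \<in> orbit shift c \<and>
     (\<forall>d\<in>orbit shift c. bead_colour (head d) \<longleftrightarrow> d < shift d)}"

definition necklaces_of :: "(nat \<Rightarrow> nat) \<times> nat list \<Rightarrow> code set multiset" where
  "necklaces_of = (\<lambda>(\<sigma>, w). image_mset (\<lambda>C. code_of \<sigma> w ` C) (mset_set (orbit \<sigma> ` {1..length w})))"

lemma code_of_inj_on_orbit:
  assumes "(\<sigma>, w) \<in> configs" "x \<in> {1..length w}"
  shows "inj_on (code_of \<sigma> w) (orbit \<sigma> x)"
proof (rule inj_onI, rule ccontr)
  fix y z assume yz: "y \<in> orbit \<sigma> x" "z \<in> orbit \<sigma> x" "code_of \<sigma> w y = code_of \<sigma> w z" "y \<noteq> z"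
  let ?A = "{1..length w}"
  have \<sigma>: "\<sigma> permutes ?A" and mono: "strict_mono_on ?A (\<lambda>i. (bead_of \<sigma> w i, \<sigma> i))"
    using assms(1) by (auto simp: configs_iff)
  have in_A: "y \<in> ?A" "z \<in> ?A" using yz permutes_orbit_subset[OF \<sigma> assms(2)] by auto
  have "cyclic_on \<sigma> (orbit \<sigma> x)" using \<sigma> by (rule cyclic_on_orbit) simp
  then have "orbit \<sigma> y = orbit \<sigma> x" "orbit \<sigma> z = orbit \<sigma> x"
    using yz(1,2) by (simp_all add: orbit_cyclic_eq3)
  then have orb: "y \<in> orbit \<sigma> z" "z \<in> orbit \<sigma> y" using yz(1,2) by auto
  have closed: "\<sigma> ` ?A \<subseteq> ?A" using permutes_image[OF \<sigma>] by simp
  from yz(4) consider "y < z" | "z < y" by linarith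
  then show False
  proof cases
    case 1
    show False
      by (rule itinerary_not_eq_above[OF mono closed _ in_A(1) orb(2) 1 yz(3)]) simp
  next
    case 2
    show False
      by (rule itinerary_not_eq_above[OF mono closed _ in_A(2) orb(1) 2 yz(3)[symmetric]]) simp
  qed
qed

lemma Union_orbits:
  assumes "\<sigma> permutes A" "finite A"
  shows "\<Union> (orbit \<sigma> ` A) = A"
proof
  show "\<Union> (orbit \<sigma> ` A) \<subseteq> A" using permutes_orbit_subset[OF assms(1)] by blast
  have "x \<in> orbit \<sigma> x" for x
    using assms by (intro permutation_self_in_orbit) (auto simp: permutation_permutes)
  then show "A \<subseteq> \<Union> (orbit \<sigma> ` A)" by blast
qed

text \<open>
  The cycles partition the positions and the code map is injective on each cycle. The lemma is used
  for the number of positions, for their weight, and for the multiset of all codes.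
\<close>

lemma sum_over_necklaces_of:
  fixes h :: "code \<Rightarrow> 'a :: comm_monoid_add"
  assumes "(\<sigma>, w) \<in> configs"
  shows "(\<Sum>N\<in>#necklaces_of (\<sigma>, w). \<Sum>c\<in>N. h c) = (\<Sum>x\<in>{1..length w}. h (code_of \<sigma> w x))"
proof -
  let ?A = "{1..length w}" and ?c = "code_of \<sigma> w"
  have \<sigma>: "\<sigma> permutes ?A" using assms by (simp add: configs_iff)
  have cyc: "cyclic_on \<sigma> (orbit \<sigma> x)" for x using \<sigma> by (rule cyclic_on_orbit) simp
  have "(\<Sum>N\<in>#necklaces_of (\<sigma>, w). \<Sum>c\<in>N. h c) = (\<Sum>C\<in>orbit \<sigma> ` ?A. \<Sum>c\<in>?c ` C. h c)"
    by (simp add: necklaces_of_def image_mset.compositionality comp_def sum_unfold_sum_mset)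
  also have "\<dots> = (\<Sum>C\<in>orbit \<sigma> ` ?A. \<Sum>x\<in>C. h (?c x))"
    using code_of_inj_on_orbit[OF assms] by (intro sum.cong refl) (auto simp: sum.reindex)
  also have "\<dots> = (\<Sum>x\<in>\<Union> (orbit \<sigma> ` ?A). h (?c x))"
  proof (subst sum.Union_disjoint)
    show "\<forall>C\<in>orbit \<sigma> ` ?A. finite C" using cyc finite_cyclic_on by blast
    show "\<forall>C\<in>orbit \<sigma> ` ?A. \<forall>D\<in>orbit \<sigma> ` ?A. C \<noteq> D \<longrightarrow> C \<inter> D = {}"
    proof (intro ballI impI, rule ccontr)
      fix C D assume C: "C \<in> orbit \<sigma> ` ?A" and D: "D \<in> orbit \<sigma> ` ?A"
        and "C \<noteq> D" "C \<inter> D \<noteq> {}"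
      then obtain z where "z \<in> C" "z \<in> D" by blast
      moreover have "cyclic_on \<sigma> C" "cyclic_on \<sigma> D" using C D cyc by auto
      ultimately have "orbit \<sigma> z = C" "orbit \<sigma> z = D" 
        using orbit_cyclic_eq3[of \<sigma> C z] orbit_cyclic_eq3[of \<sigma> D z] by auto
      with \<open>C \<noteq> D\<close> show False by simp
    qed
  qed simp
  finally show ?thesis using Union_orbits[OF \<sigma>] by simp
qed

text \<open>
  Codes are weakly increasing in the position, and a point that is moved by \<open>\<sigma>\<close> has a code different
  from that of its image because both lie on one cycle.
\<close>

lemma code_of_shift_less_iff:
  assumes "(\<sigma>, w) \<in> configs" "x \<in> {1..length w}"
  shows "code_of \<sigma> w x < shift (code_of \<sigma> w x) \<longleftrightarrow> x < \<sigma> x"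
proof -
  let ?A = "{1..length w}"
  have \<sigma>: "\<sigma> permutes ?A" and mono: "strict_mono_on ?A (\<lambda>i. (bead_of \<sigma> w i, \<sigma> i))"
    using assms(1) by (auto simp: configs_iff)
  have closed: "\<sigma> ` ?A \<subseteq> ?A" using permutes_image[OF \<sigma>] by simp
  have \<sigma>x: "\<sigma> x \<in> ?A" using assms(2) closed by blast
  have self: "x \<in> orbit \<sigma> x"
    using \<sigma> by (intro permutation_self_in_orbit) (auto simp: permutation_permutes)
  show ?thesis
  proof (cases "x < \<sigma> x")
    case True
    then have "code_of \<sigma> w x \<noteq> code_of \<sigma> w (\<sigma> x)"
      using inj_onD[OF code_of_inj_on_orbit[OF assms], of x "\<sigma> x"] self orbit.base[of \<sigma> x] by auto
    with True itinerary_mono[OF mono closed assms(2) \<sigma>x] show ?thesis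
      by (simp add: shift_itinerary)
  next
    case False
    then have "code_of \<sigma> w (\<sigma> x) \<le> code_of \<sigma> w x"
      using itinerary_mono[OF mono closed \<sigma>x assms(2)] by (cases "\<sigma> x = x") auto
    with False show ?thesis by (simp add: shift_itinerary)
  qed
qed

lemma necklaces_of_subset:
  assumes "(\<sigma>, w) \<in> configs"
  shows "set_mset (necklaces_of (\<sigma>, w)) \<subseteq> necklaces"
proof
  let ?A = "{1..length w}" and ?c = "code_of \<sigma> w"
  have \<sigma>: "\<sigma> permutes ?A" using assms by (simp add: configs_iff)
  fix N assume "N \<in># necklaces_of (\<sigma>, w)"
  then obtain x where x: "x \<in> ?A" and N: "N = ?c ` orbit \<sigma> x" by (auto simp: necklaces_of_def)
  have self: "x \<in> orbit \<sigma> x"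
    using \<sigma> by (intro permutation_self_in_orbit) (auto simp: permutation_permutes)
  have N': "N = orbit shift (?c x)"
    unfolding N by (rule orbit_inverse[OF self]) (simp add: shift_itinerary)
  moreover have "?c x \<in> orbit shift (?c x)"
    unfolding N'[symmetric] N using self by (rule imageI)
  moreover have "bead_colour (head d) \<longleftrightarrow> d < shift d" if dN: "d \<in> N" for d
  proof -
    obtain y where y: "y \<in> orbit \<sigma> x" "d = ?c y" using dN N by blast
    then have "y \<in> ?A" using permutes_orbit_subset[OF \<sigma> x] by blast
    then show ?thesis using code_of_shift_less_iff[OF assms] y by (simp add: bead_of_def)
  qed
  ultimately show "N \<in> necklaces" unfolding necklaces_def by blast
qed

lemma card_necklaces_of:
  assumes "(\<sigma>, w) \<in> configs"
  shows "image_mset card (necklaces_of (\<sigma>, w)) = cycle_type (length w) \<sigma>"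
proof -
  have "card (code_of \<sigma> w ` C) = card C" if "C \<in># mset_set (orbit \<sigma> ` {1..length w})" for C
    using that code_of_inj_on_orbit[OF assms] by (auto simp: card_image)
  then show ?thesis
    unfolding necklaces_of_def cycle_type_def case_prod_conv image_mset.compositionality comp_def
    by (rule image_mset_cong)
qed

lemma length_necklaces_of:
  assumes "(\<sigma>, w) \<in> configs"
  shows "length w = (\<Sum>N\<in>#necklaces_of (\<sigma>, w). card N)"
  using sum_over_necklaces_of[OF assms, of "\<lambda>_. 1 :: nat"] by simp

text \<open>
  The multiset of all codes carries the same information as the multiset of necklaces
  (\<open>codes_of_inject\<close>), but it can be sorted.
\<close>

definition codes_of :: "code set multiset \<Rightarrow> code multiset" where
  "codes_of \<N> = (\<Sum>N\<in>#\<N>. mset_set N)"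

lemma codes_of_necklaces_of:
  assumes "(\<sigma>, w) \<in> configs"
  shows "codes_of (necklaces_of (\<sigma>, w)) = image_mset (code_of \<sigma> w) (mset_set {1..length w})"
  using sum_over_necklaces_of[OF assms, of "\<lambda>c. {#c#}"]
  by (simp add: codes_of_def) (simp add: sum_unfold_sum_mset image_mset.compositionality comp_def)

lemma necklace_eq_orbit:
  assumes "N \<in> necklaces" "d \<in> N"
  shows "d \<in> orbit shift d" "N = orbit shift d"
proof -
  from assms(1) obtain c where c: "N = orbit shift c" "c \<in> orbit shift c"
    by (auto simp: necklaces_def)
  then have "cyclic_on shift N" by (auto simp: cyclic_on_def)
  then show "N = orbit shift d" using orbit_cyclic_eq3[of shift N d] assms(2) by simp
  then show "d \<in> orbit shift d" using assms(2) by simp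
qed

lemma finite_necklace: "N \<in> necklaces \<Longrightarrow> finite N"
  by (auto simp: necklaces_def finite_orbit)

text \<open>
  A necklace containing \<open>d\<close> is the shift orbit of \<open>d\<close>, so necklaces are disjoint or equal.
\<close>

lemma count_codes_of:
  assumes "set_mset \<N> \<subseteq> necklaces"
  shows "count (codes_of \<N>) d = (if d \<in> orbit shift d then count \<N> (orbit shift d) else 0)"
  using assms
proof (induction \<N>)
  case (add N \<N>)
  then have N: "N \<in> necklaces" by simp
  have "d \<in> N \<longleftrightarrow> d \<in> orbit shift d \<and> N = orbit shift d" using necklace_eq_orbit[OF N] by blast
  with add finite_necklace[OF N] show ?case by (auto simp: codes_of_def count_mset_set')
qed (simp add: codes_of_def)

lemma codes_of_inject:
  assumes "set_mset \<N> \<subseteq> necklaces" "set_mset \<N>' \<subseteq> necklaces" "codes_of \<N> = codes_of \<N>'"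
  shows "\<N> = \<N>'"
proof (rule multiset_eqI)
  fix N
  show "count \<N> N = count \<N>' N"
  proof (cases "N \<in> necklaces")
    case True
    then obtain c where "N = orbit shift c" "c \<in> orbit shift c" by (auto simp: necklaces_def)
    then show ?thesis using count_codes_of[OF assms(1), of c] count_codes_of[OF assms(2), of c] assms(3)
      by simp
  next
    case False
    then have "N \<notin># \<N>" "N \<notin># \<N>'" using assms by auto
    then show ?thesis by (simp add: not_in_iff)
  qed
qed

section \<open>Bijection between permutations with words and multisets of necklaces\<close>

lemma map_code_of_sorted:
  assumes "(\<sigma>, w) \<in> configs"
  shows "sorted (map (code_of \<sigma> w) [1..<Suc (length w)])"
proof -
  let ?A = "{1..length w}"
  have \<sigma>: "\<sigma> permutes ?A" and mono: "strict_mono_on ?A (\<lambda>i. (bead_of \<sigma> w i, \<sigma> i))"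
    using assms(1) by (auto simp: configs_iff)
  have closed: "\<sigma> ` ?A \<subseteq> ?A" using permutes_image[OF \<sigma>] by simp
  show ?thesis
    unfolding sorted_wrt_map
    by (rule sorted_wrt_mono_rel[OF _ sorted_wrt_upt]) (auto intro: itinerary_mono[OF mono closed])
qed

text \<open>
  One step of the proof that the codes determine \<open>\<sigma>\<close>. Let \<open>i\<close> be the first position where two
  permutations with the same codes could differ and suppose \<open>\<sigma> i < \<sigma>' i\<close>. The position \<open>k\<close> that \<open>\<sigma>'\<close>
  sends to \<open>\<sigma> i\<close> has the same code as \<open>i\<close>, since the shift is injective on periodic codes; as \<open>\<sigma>'\<close>
  is increasing on positions with equal codes, \<open>k < i\<close>. But there the permutations agree, so
  \<open>\<sigma> k = \<sigma> i\<close>.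
\<close>

lemma codes_determine_perm:
  assumes C: "(\<sigma>, w) \<in> configs" "(\<sigma>', w) \<in> configs"
    and eq: "\<And>i. i \<in> {1..length w} \<Longrightarrow> code_of \<sigma> w i = code_of \<sigma>' w i"
    and i: "i \<in> {1..length w}" "\<And>k. k \<in> {1..length w} \<Longrightarrow> k < i \<Longrightarrow> \<sigma> k = \<sigma>' k"
  shows "\<not> \<sigma> i < \<sigma>' i"
proof
  assume less: "\<sigma> i < \<sigma>' i"
  let ?A = "{1..length w}"
  have \<sigma>: "\<sigma> permutes ?A" and \<sigma>': "\<sigma>' permutes ?A"
    and mono: "strict_mono_on ?A (\<lambda>i. (bead_of \<sigma>' w i, \<sigma>' i))"
    using C by (auto simp: configs_iff)
  have "\<sigma> i \<in> ?A" using i(1) permutes_in_image[OF \<sigma>] by simp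
  then have "\<sigma> i \<in> \<sigma>' ` ?A" using permutes_image[OF \<sigma>'] by simp
  then obtain k where k: "k \<in> ?A" "\<sigma>' k = \<sigma> i" by (metis imageE)
  have periodic: "code_of \<sigma>' w j \<in> orbit shift (code_of \<sigma>' w j)" if "j \<in> ?A" for j
  proof -
    have "j \<in> orbit \<sigma>' j"
      using \<sigma>' by (intro permutation_self_in_orbit) (auto simp: permutation_permutes)
    then have "code_of \<sigma>' w ` orbit \<sigma>' j = orbit shift (code_of \<sigma>' w j)"
      by (rule orbit_inverse) (simp add: shift_itinerary)
    then show ?thesis using \<open>j \<in> orbit \<sigma>' j\<close> by blast
  qed
  have "shift (code_of \<sigma>' w k) = code_of \<sigma>' w (\<sigma> i)" using k by (simp add: shift_itinerary)
  also have "\<dots> = code_of \<sigma> w (\<sigma> i)" using eq \<open>\<sigma> i \<in> ?A\<close> by simp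
  also have "\<dots> = shift (code_of \<sigma>' w i)" using eq[OF i(1)] by (simp flip: shift_itinerary)
  finally have same: "code_of \<sigma>' w k = code_of \<sigma>' w i"
    by (rule shift_inj_periodic[OF periodic[OF k(1)] periodic[OF i(1)]])
  then have "bead_of \<sigma>' w k = bead_of \<sigma>' w i" by (metis head_itinerary)
  then have "k < i"
    using equal_beads_keep_order[OF mono i(1) k(1)] less k(2)
    by (cases k i rule: linorder_cases) auto
  then have "\<sigma> k = \<sigma> i" using i(2)[OF k(1)] k(2) by simp
  then show False using permutes_inj[OF \<sigma>] \<open>k < i\<close> by (auto dest: injD)
qed

lemma necklaces_of_inj: "inj_on necklaces_of configs"
proof (rule inj_onI)
  fix p p' assume "p \<in> configs" "p' \<in> configs" and nn: "necklaces_of p = necklaces_of p'"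
  moreover obtain \<sigma> w \<sigma>' w' where p: "p = (\<sigma>, w)" "p' = (\<sigma>', w')" by fastforce
  ultimately have C: "(\<sigma>, w) \<in> configs" and C': "(\<sigma>', w') \<in> configs" by auto
  have len: "length w = length w'" using length_necklaces_of[OF C] length_necklaces_of[OF C'] nn p by simp
  let ?n = "length w" and ?A = "{1..length w}"
  have "mset (map (code_of \<sigma> w) [1..<Suc ?n]) = mset (map (code_of \<sigma>' w') [1..<Suc ?n])"
    using codes_of_necklaces_of[OF C] codes_of_necklaces_of[OF C'] nn p len
    by (simp add: atLeastLessThanSuc_atLeastAtMost del: upt_Suc)
  then have "map (code_of \<sigma> w) [1..<Suc ?n] = map (code_of \<sigma>' w') [1..<Suc ?n]"
    using map_code_of_sorted[OF C] map_code_of_sorted[OF C'] len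
    by (metis properties_for_sort)
  then have eq: "code_of \<sigma> w i = code_of \<sigma>' w' i" if "i \<in> ?A" for i
    using that by (simp add: map_eq_conv del: upt_Suc)
  have "w = w'"
  proof (rule nth_equalityI[OF len])
    fix i assume "i < ?n"
    then have "head (code_of \<sigma> w (Suc i)) = head (code_of \<sigma>' w' (Suc i))"
      using eq[of "Suc i"] by simp
    then have "bead_of \<sigma> w (Suc i) = bead_of \<sigma>' w' (Suc i)" by simp
    then show "w ! i = w' ! i" by (auto simp: bead_of_def split: if_splits)
  qed
  note C' = C'[folded this] and eq = eq[folded this]
  have "\<sigma> i = \<sigma>' i" for i
  proof (induction i rule: less_induct)
    case (less i)
    show ?case
    proof (cases "i \<in> ?A")
      case True
      have "\<not> \<sigma> i < \<sigma>' i" "\<not> \<sigma>' i < \<sigma> i"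
        using codes_determine_perm[OF C C' eq True] codes_determine_perm[OF C' C eq[symmetric] True]
          less by auto
      then show ?thesis by simp
    next
      case False
      then show ?thesis using C C' by (auto simp: configs_iff permutes_def)
    qed
  qed
  with \<open>w = w'\<close> show "p = p'" using p by (simp add: fun_eq_iff)
qed

lemma finite_linorder_enumeration:
  fixes P :: "'a :: linorder set"
  assumes "finite P"
  shows "\<exists>e. bij_betw e {1..card P} P \<and> strict_mono_on {1..card P} e"
proof (intro exI conjI)
  let ?xs = "sorted_list_of_set P"
  have "bij_betw (\<lambda>i. i - 1) {1..card P} {..<card P}"
    by (rule bij_betw_byWitness[where f' = Suc]) auto
  moreover have "bij_betw ((!) ?xs) {..<card P} P"
    by (rule bij_betw_nth) (use assms in auto)
  ultimately show "bij_betw ((!) ?xs \<circ> (\<lambda>i. i - 1)) {1..card P} P" by (rule bij_betw_trans)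
  show "strict_mono_on {1..card P} ((!) ?xs \<circ> (\<lambda>i. i - 1))"
    by (rule strict_mono_onI)
       (auto intro!: sorted_wrt_nth_less[OF strict_sorted_list_of_set])
qed

text \<open>
  Take \<open>count M d\<close> numbered copies \<open>(d, k)\<close> of every code \<open>d\<close> in the multiset \<open>M\<close> of all codes and
  number these pairs lexicographically by \<open>1, \<dots>, n\<close>. The permutation is \<open>(d, k) \<mapsto> (shift d, k)\<close>, read
  through this numbering, and the word consists of the letters of the first beads. With equal first
  beads, codes compare like their shifts, so the order condition holds; the colour condition of
  necklaces makes the red beads the excedances. Matching copies by their number \<open>k\<close> is what makes the
  permutation increasing on positions with equal codes.
\<close>

lemma necklaces_of_surj:
  assumes \<N>: "set_mset \<N> \<subseteq> necklaces"
  shows "\<N> \<in> necklaces_of ` configs"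
proof -
  let ?M = "codes_of \<N>"
  define P where "P = (SIGMA d : set_mset ?M. {..<count ?M d})"
  define n where "n = card P"
  have finP: "finite P" unfolding P_def by simp
  have P_iff: "(d, k) \<in> P \<longleftrightarrow> k < count ?M d" for d k
    by (auto simp: P_def dest: order.strict_trans1[rotated] simp flip: count_greater_zero_iff)
  obtain e where e: "bij_betw e {1..n} P" "strict_mono_on {1..n} e"
    using finite_linorder_enumeration[OF finP] unfolding n_def by blast
  have periodic: "d \<in> orbit shift d" if "(d, k) \<in> P" for d k
    using that unfolding P_iff count_codes_of[OF \<N>] by (auto split: if_splits)
  have colour: "bead_colour (head d) \<longleftrightarrow> d < shift d" if "(d, k) \<in> P" for d k
  proof -
    have "orbit shift d \<in># \<N>" 
      using that periodic[OF that] unfolding P_iff count_codes_of[OF \<N>]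
      by (metis not_in_iff not_less_zero)
    then have "orbit shift d \<in> necklaces" using \<N> by blast
    then show ?thesis using periodic[OF that] by (auto simp: necklaces_def)
  qed
  define adv where "adv = (\<lambda>(d, k :: nat). (shift d, k))"
  \<comment> \<open>Since the multiset contains \<open>d\<close> and \<open>shift d\<close> equally often, the shift permutes the copies.\<close>
  have adv_P: "adv z \<in> P" if "z \<in> P" for z
  proof -
    obtain d k where z: "z = (d, k)" by fastforce
    have d: "d \<in> orbit shift d" using that periodic z by blast
    have "shift d \<in> orbit shift (shift d)" "orbit shift (shift d) = orbit shift d"
      using d by (auto simp: self_in_orbit_step intro: orbit.base)
    then show ?thesis using that d unfolding z adv_def by (simp add: P_iff count_codes_of[OF \<N>])
  qed
  have "inj_on adv P"
  proof (rule inj_onI)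
    fix z z' assume "z \<in> P" "z' \<in> P" "adv z = adv z'"
    then show "z = z'" using shift_inj_periodic periodic
      by (cases z; cases z') (simp add: adv_def)
  qed
  moreover have "adv ` P \<subseteq> P" using adv_P by blast
  ultimately have adv: "bij_betw adv P P" using finP by (simp add: bij_betw_def endo_inj_surj)
  let ?A = "{1..n}"
  define \<sigma> where "\<sigma> i = (if i \<in> ?A then inv_into ?A e (adv (e i)) else i)" for i
  define w where "w = map (\<lambda>i. bead_value (head (fst (e (Suc i))))) [0..<n]"
  have len: "length w = n" by (simp add: w_def)
  have "bij_betw (inv_into ?A e \<circ> (adv \<circ> e)) ?A ?A"
    using e(1) adv bij_betw_inv_into by (blast intro: bij_betw_trans)
  then have "bij_betw \<sigma> ?A ?A" by (rule bij_betw_cong[THEN iffD1, rotated]) (simp add: \<sigma>_def)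
  then have \<sigma>: "\<sigma> permutes ?A" by (rule bij_imp_permutes) (auto simp: \<sigma>_def)
  have eP: "e i \<in> P" if "i \<in> ?A" for i using that e(1) bij_betwE by blast
  have \<sigma>A: "\<sigma> i \<in> ?A" if "i \<in> ?A" for i using permutes_in_image[OF \<sigma>] that by blast
  have e\<sigma>: "e (\<sigma> i) = adv (e i)" if "i \<in> ?A" for i
    using that adv_P[OF eP[OF that]] e(1) by (simp add: \<sigma>_def bij_betw_inv_into_right)
  have e_less: "e i < e j \<longleftrightarrow> i < j" if "i \<in> ?A" "j \<in> ?A" for i j
    using strict_mono_on_less[OF e(2) that] .
  have bead: "bead_of \<sigma> w i = head (fst (e i))" if i: "i \<in> ?A" for i
  proof -
    obtain d k where d: "e i = (d, k)" by fastforce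
    then have "(d, k) \<in> P" using eP[OF i] by simp
    have "i < \<sigma> i \<longleftrightarrow> e i < adv (e i)" using e_less[OF i \<sigma>A[OF i]] e\<sigma>[OF i] by simp
    also have "\<dots> \<longleftrightarrow> bead_colour (head d)"
      using colour[OF \<open>(d, k) \<in> P\<close>] by (simp add: d adv_def less_prod_def')
    finally have "i < \<sigma> i \<longleftrightarrow> bead_colour (head d)" .
    moreover have "w ! (i - 1) = bead_value (head d)"
      using i d by (cases i) (auto simp: w_def)
    ultimately show ?thesis by (cases "head d") (auto simp: bead_of_def d)
  qed
  have "(\<sigma>, w) \<in> configs"
    unfolding configs_iff len
  proof (intro conjI \<sigma> strict_mono_onI)
    fix i j assume ij: "i \<in> ?A" "j \<in> ?A" "i < j"
    obtain d k d' k' where d: "e i = (d, k)" "e j = (d', k')" by fastforce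
    have less: "(d, k) < (d', k')" using e_less[OF ij(1,2)] ij(3) d by simp
    then have "head d \<le> head d'" by (auto intro: head_mono)
    moreover have "\<sigma> i < \<sigma> j" if "head d = head d'"
    proof -
      have "adv (d, k) < adv (d', k')"
        using less shift_less_iff[OF that] by (auto simp: adv_def less_prod_def')
      then have "e (\<sigma> i) < e (\<sigma> j)" using ij(1,2) by (simp only: e\<sigma> d)
      then show ?thesis using e_less[OF \<sigma>A[OF ij(1)] \<sigma>A[OF ij(2)]] by blast
    qed
    ultimately show "(bead_of \<sigma> w i, \<sigma> i) < (bead_of \<sigma> w j, \<sigma> j)"
      using bead ij(1,2) d by (auto simp: less_prod_def')
  qed
  moreover have "necklaces_of (\<sigma>, w) = \<N>"
  proof (rule codes_of_inject)
    have code: "code_of \<sigma> w i = fst (e i)" if i: "i \<in> ?A" for i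
    proof (rule code.expand, rule ext)
      fix k
      have it: "(\<sigma> ^^ k) i \<in> ?A \<and> fst (e ((\<sigma> ^^ k) i)) = (shift ^^ k) (fst (e i))" for k
      proof (induction k)
        case (Suc k)
        then show ?case
          using \<sigma>A[of "(\<sigma> ^^ k) i"] e\<sigma>[of "(\<sigma> ^^ k) i"] by (simp add: adv_def case_prod_unfold)
      qed (use i in simp)
      have "bead_of \<sigma> w ((\<sigma> ^^ k) i) = head ((shift ^^ k) (fst (e i)))"
        using it[of k] bead[of "(\<sigma> ^^ k) i"] by simp
      then have "bead_of \<sigma> w ((\<sigma> ^^ k) i) = bead_at (fst (e i)) k"
        by (simp add: head_funpow_shift)
      then show "bead_at (code_of \<sigma> w i) k = bead_at (fst (e i)) k" by (simp add: itinerary_def)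
    qed
    have "codes_of (necklaces_of (\<sigma>, w)) = image_mset (fst \<circ> e) (mset_set ?A)"
      unfolding codes_of_necklaces_of[OF \<open>(\<sigma>, w) \<in> configs\<close>] len
      by (rule image_mset_cong) (simp add: code)
    also have "\<dots> = image_mset fst (mset_set P)"
      using e(1) image_mset_mset_set[of e ?A] by (simp add: bij_betw_def flip: image_mset.compositionality)
    also have "\<dots> = ?M"
    proof (rule multiset_eqI)
      fix d
      have "{p \<in> P. fst p = d} = {d} \<times> {..<count ?M d}" by (auto simp: P_iff)
      then show "count (image_mset fst (mset_set P)) d = count ?M d"
        by (simp add: count_image_mset_eq_card_vimage[OF finP])
    qed
    finally show "codes_of (necklaces_of (\<sigma>, w)) = ?M" .
  qed (use \<N> necklaces_of_subset[OF \<open>(\<sigma>, w) \<in> configs\<close>] in auto)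
  ultimately show ?thesis by blast
qed

theorem necklaces_of_bij: "bij_betw necklaces_of configs {\<N>. set_mset \<N> \<subseteq> necklaces}"
  unfolding bij_betw_def using necklaces_of_inj necklaces_of_surj necklaces_of_subset by auto

section \<open>Ornaments and the identity for a fixed cycle type\<close>

fun bead_weight :: "bead \<Rightarrow> var multiset" where
  "bead_weight (Red a) = {#X a, T#}"
| "bead_weight (Blue a) = {#X a#}"

definition necklace_weight :: "code set \<Rightarrow> var multiset" where
  "necklace_weight N = (\<Sum>c\<in>N. bead_weight (head c))"

definition config_weight :: "(nat \<Rightarrow> nat) \<times> nat list \<Rightarrow> var multiset" where
  "config_weight = (\<lambda>(\<sigma>, w). mset (map X w) + replicate_mset (exc (length w) \<sigma>) T)"

lemma sum_replicate_mset_1: "(\<Sum>i\<in>A. {#x#}) = replicate_mset (card A) x"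
  by (induction A rule: infinite_finite_induct) auto

lemma config_weight_eq_sum:
  assumes \<sigma>: "\<sigma> permutes {1..length w}"
  shows "config_weight (\<sigma>, w) = (\<Sum>i\<in>{1..length w}. bead_weight (bead_of \<sigma> w i))"
proof -
  let ?A = "{1..length w}"
  have "(\<Sum>i\<in>?A. bead_weight (bead_of \<sigma> w i))
      = (\<Sum>i\<in>?A. {#X (w ! (i - 1))#}) + (\<Sum>i\<in>?A. if i < \<sigma> i then {#T#} else {#})"
    unfolding sum.distrib[symmetric] by (intro sum.cong) (auto simp: bead_of_def)
  also have "(\<Sum>i\<in>?A. {#X (w ! (i - 1))#}) = mset (map X w)"
  proof -
    have "(\<Sum>i\<in>?A. {#X (w ! (i - 1))#}) = (\<Sum>i\<in>{0..<length w}. {#X (w ! i)#})"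
      by (rule sum.reindex_bij_witness[of _ Suc "\<lambda>i. i - 1"]) auto
    also have "\<dots> = mset (map (\<lambda>i. X (w ! i)) [0..<length w])"
      by (simp add: sum_unfold_sum_mset)
    also have "map (\<lambda>i. X (w ! i)) [0..<length w] = map X w"
      by (rule nth_equalityI) auto
    finally show ?thesis .
  qed
  also have "(\<Sum>i\<in>?A. if i < \<sigma> i then {#T#} else {#}) = replicate_mset (exc (length w) \<sigma>) T"
  proof -
    have "{i \<in> ?A. i < \<sigma> i} = EXC (length w) \<sigma>"
    proof -
      have "i \<noteq> length w" if "i \<in> ?A" "i < \<sigma> i" for i
        using that permutes_in_image[OF \<sigma>, of i] by auto
      then show ?thesis by (force simp: EXC_def)
    qed
    then show ?thesis
      by (simp add: exc_def sum.inter_filter[symmetric] sum_replicate_mset_1)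
  qed
  finally show ?thesis by (simp add: config_weight_def)
qed

lemma necklaces_of_weight:
  assumes "(\<sigma>, w) \<in> configs"
  shows "(\<Sum>N\<in>#necklaces_of (\<sigma>, w). necklace_weight N) = config_weight (\<sigma>, w)"
  using assms config_weight_eq_sum[of \<sigma> w] sum_over_necklaces_of[OF assms, of "\<lambda>c. bead_weight (head c)"]
  by (simp add: necklace_weight_def configs_iff)

lemma Fqs_times_monom:
  "Fqs S n * monom v = gen_fun (fqs_words S n) (\<lambda>w. mset (map X w) + v)"
proof -
  have "Fqs S n = gen_fun (fqs_words S n) (\<lambda>w. mset (map X w))"
    by (rule mfps_eqI) (simp add: mcoeff_Fqs mcoeff_gen_fun)
  then show ?thesis by (simp add: gen_fun_times_monom)
qed

lemma finite_fibres_fqs_words: "finite_fibres (fqs_words S n) (\<lambda>w. mset (map X w) + v)"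
  unfolding finite_fibres_def
proof
  fix u
  have "{w \<in> fqs_words S n. mset (map X w) + v = u} \<subseteq> {w. set w \<subseteq> X -` set_mset u \<and> length w = n}"
    by (auto simp: fqs_words_def)
  moreover have "finite (X -` set_mset u)" by (rule finite_vimageI) (auto intro: injI)
  ultimately show "finite {w \<in> fqs_words S n. mset (map X w) + v = u}"
    by (rule finite_subset[OF _ finite_lists_length_eq])
qed

lemma sum_Fqs_times_monom:
  assumes "finite B"
  shows "(\<Sum>\<sigma>\<in>B. Fqs (DEX n \<sigma>) n * monom (v \<sigma>)) =
    gen_fun (SIGMA \<sigma>:B. fqs_words (DEX n \<sigma>) n) (\<lambda>(\<sigma>, w). mset (map X w) + v \<sigma>)"
  unfolding Fqs_times_monom using assms by (rule sum_gen_fun_Sigma) (rule finite_fibres_fqs_words)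

lemma finite_permutes: "finite {\<sigma>. \<sigma> permutes {1..n :: nat} \<and> P \<sigma>}"
  by (rule finite_subset[OF _ finite_permutations[of "{1..n}"]]) auto

lemma sum_mset_cycle_type:
  assumes "(\<sigma>, w) \<in> configs"
  shows "sum_mset (cycle_type (length w) \<sigma>) = length w"
  using length_necklaces_of[OF assms] card_necklaces_of[OF assms] by simp

lemma filter_mset_all: "(\<And>x. x \<in># M \<Longrightarrow> P x) \<Longrightarrow> filter_mset P M = M"
  by (induction M) auto

lemma filter_mset_none: "(\<And>x. x \<in># M \<Longrightarrow> \<not> P x) \<Longrightarrow> filter_mset P M = {#}"
  by (induction M) auto

definition ornaments :: "nat multiset \<Rightarrow> code set multiset set" where
  "ornaments lam = {\<N>. set_mset \<N> \<subseteq> necklaces \<and> image_mset card \<N> = lam}"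

abbreviation ornament_weight :: "code set multiset \<Rightarrow> var multiset" where
  "ornament_weight \<N> \<equiv> \<Sum>N\<in>#\<N>. necklace_weight N"

lemma configs_ornaments_bij:
  "bij_betw necklaces_of {(\<sigma>, w) \<in> configs. cycle_type (length w) \<sigma> = lam} (ornaments lam)"
proof -
  have "bij_betw necklaces_of {p \<in> configs. case p of (\<sigma>, w) \<Rightarrow> cycle_type (length w) \<sigma> = lam}
      {\<N> \<in> {\<N>. set_mset \<N> \<subseteq> necklaces}. image_mset card \<N> = lam}"
    by (rule bij_betw_Collect[OF necklaces_of_bij]) (auto simp: card_necklaces_of)
  then show ?thesis by (simp add: ornaments_def case_prod_unfold)
qed

lemma configs_of_type:
  "{(\<sigma>, w) \<in> configs. cycle_type (length w) \<sigma> = lam} =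
    (SIGMA \<sigma>:{\<sigma>. \<sigma> permutes {1..sum_mset lam} \<and> cycle_type (sum_mset lam) \<sigma> = lam}.
       fqs_words (DEX (sum_mset lam) \<sigma>) (sum_mset lam))"
proof -
  have "length w = sum_mset lam" if "(\<sigma>, w) \<in> configs" "cycle_type (length w) \<sigma> = lam" for \<sigma> w
    using sum_mset_cycle_type[OF that(1)] that(2) by simp
  then show ?thesis by (auto simp: configs_def fqs_words_def)
qed

lemma exc_le: "exc n \<sigma> \<le> n - 1"
proof -
  have "card (EXC n \<sigma>) \<le> card {1..n-1}" by (rule card_mono) (auto simp: EXC_def)
  then show ?thesis by (simp add: exc_def)
qed

text \<open>
  Multiplication by \<open>t\<^sup>j\<close> and summation over \<open>j\<close> merely adds the number of excedances, that is of red
  beads, to the weight. The range of \<open>j\<close> loses nothing by \<open>exc_le\<close>.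
\<close>

theorem sum_Qlam:
  "(\<Sum>j=0..sum_mset lam - 1. Qlam lam j * mvar T ^ j) = gen_fun (ornaments lam) ornament_weight"
proof -
  let ?n = "sum_mset lam"
  let ?B = "{\<sigma>. \<sigma> permutes {1..?n} \<and> cycle_type ?n \<sigma> = lam}"
  let ?f = "\<lambda>\<sigma>. Fqs (DEX ?n \<sigma>) ?n * monom (replicate_mset (exc ?n \<sigma>) T)"
  have "(\<Sum>j=0..?n - 1. Qlam lam j * mvar T ^ j) = (\<Sum>j=0..?n - 1. \<Sum>\<sigma>\<in>{\<sigma> \<in> ?B. exc ?n \<sigma> = j}. ?f \<sigma>)"
    by (rule sum.cong) (auto simp: Qlam_def Let_def mvar_power sum_distrib_right intro!: sum.cong)
  also have "\<dots> = (\<Sum>\<sigma>\<in>?B. ?f \<sigma>)"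
    by (rule sum.group) (use finite_permutes exc_le in auto)
  also have "\<dots> = gen_fun {(\<sigma>, w) \<in> configs. cycle_type (length w) \<sigma> = lam}
      (\<lambda>(\<sigma>, w). mset (map X w) + replicate_mset (exc ?n \<sigma>) T)"
    unfolding configs_of_type by (rule sum_Fqs_times_monom[OF finite_permutes])
  also have "\<dots> = gen_fun (ornaments lam) ornament_weight"
    by (rule gen_fun_bij[OF configs_ornaments_bij])
       (auto simp: necklaces_of_weight config_weight_def sum_mset_cycle_type)
  finally show ?thesis .
qed

lemma finite_fibres_ornaments: "finite_fibres (ornaments lam) ornament_weight"
proof (rule finite_fibres_bij[OF configs_ornaments_bij, THEN iffD1, rotated])
  let ?n = "sum_mset lam"
  let ?B = "{\<sigma>. \<sigma> permutes {1..?n} \<and> cycle_type ?n \<sigma> = lam}"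
  show "finite_fibres {(\<sigma>, w) \<in> configs. cycle_type (length w) \<sigma> = lam} config_weight"
    unfolding finite_fibres_def
  proof
    fix u
    have "{p \<in> {(\<sigma>, w) \<in> configs. cycle_type (length w) \<sigma> = lam}. config_weight p = u}
      \<subseteq> ?B \<times> {w. set w \<subseteq> X -` set_mset u \<and> length w = ?n}"
      unfolding configs_of_type by (auto simp: config_weight_def fqs_words_def)
    moreover have "finite (X -` set_mset u)" by (rule finite_vimageI) (auto intro: injI)
    ultimately show "finite {p \<in> {(\<sigma>, w) \<in> configs. cycle_type (length w) \<sigma> = lam}. config_weight p = u}"
      by (rule finite_subset[OF _ finite_cartesian_product[OF finite_permutes finite_lists_length_eq]])
  qed
qed (auto simp: necklaces_of_weight)

lemma ornaments_singleton:
  "bij_betw (\<lambda>N. {#N#}) {N \<in> necklaces. card N = i} (ornaments {#i#})"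
proof (rule bij_betwI')
  fix \<N> assume "\<N> \<in> ornaments {#i#}"
  then have \<N>: "set_mset \<N> \<subseteq> necklaces" "image_mset card \<N> = {#i#}" by (auto simp: ornaments_def)
  then have "size \<N> = 1" by (metis size_image_mset size_single)
  then obtain N where "\<N> = {#N#}" using size_1_singleton_mset by blast
  with \<N> show "\<exists>N\<in>{N \<in> necklaces. card N = i}. \<N> = {#N#}" by auto
qed (auto simp: ornaments_def)

lemma ornaments_replicate:
  "ornaments (replicate_mset m i) =
    {\<N>. set_mset \<N> \<subseteq> {N \<in> necklaces. card N = i} \<and> size \<N> = m}"
proof -
  have "image_mset card \<N> = replicate_mset m i \<longleftrightarrow> (\<forall>N\<in>#\<N>. card N = i) \<and> size \<N> = m" for \<N> :: "code set multiset"
  proof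
    assume eq: "image_mset card \<N> = replicate_mset m i"
    have "size \<N> = m" using arg_cong[OF eq, of size] by simp
    moreover have "card N = i" if "N \<in># \<N>" for N
    proof -
      have "card N \<in># image_mset card \<N>" using that by simp
      then show ?thesis unfolding eq by (simp split: if_splits)
    qed
    ultimately show "(\<forall>N\<in>#\<N>. card N = i) \<and> size \<N> = m" by blast
  next
    assume *: "(\<forall>N\<in>#\<N>. card N = i) \<and> size \<N> = m"
    then have "image_mset card \<N> = image_mset (\<lambda>_. i) \<N>" by (intro image_mset_cong) auto
    then show "image_mset card \<N> = replicate_mset m i" using * by (simp add: image_mset_const_eq)
  qed
  then show ?thesis by (auto simp: ornaments_def)
qed

text \<open>
  Ornaments with a single part are single necklaces, and ornaments with \<open>m\<close> equal parts are the
  multisets of \<open>m\<close> such necklaces.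
\<close>

lemma plethysm_hsym_single_cycle:
  "plethysm (hsym m) (gen_fun (ornaments {#i#}) ornament_weight) =
    gen_fun (ornaments (replicate_mset m i)) ornament_weight"
proof -
  let ?A = "{N \<in> necklaces. card N = i}"
  have "gen_fun ?A necklace_weight = gen_fun (ornaments {#i#}) ornament_weight"
    by (rule gen_fun_bij[OF ornaments_singleton]) simp
  moreover have "finite_fibres ?A necklace_weight"
    using finite_fibres_ornaments
    by (subst finite_fibres_bij[OF ornaments_singleton, where wt' = ornament_weight]) simp_all
  ultimately show ?thesis
    using plethysm_hsym_gen_fun[of ?A necklace_weight m] by (simp add: ornaments_replicate)
qed

text \<open>
  If \<open>A\<close> and \<open>B\<close> have no part in common, the size of a necklace tells to which factor it belongs.
\<close>

lemma gen_fun_ornaments_times: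
  assumes disj: "set_mset A \<inter> set_mset B = {}"
  shows "gen_fun (ornaments A) ornament_weight * gen_fun (ornaments B) ornament_weight =
    gen_fun (ornaments (A + B)) ornament_weight"
proof -
  let ?P = "\<lambda>N. card N \<in># A" and ?Q = "\<lambda>N. card N \<notin># A"
  have bij: "bij_betw (\<lambda>(\<M>, \<N>). \<M> + \<N>) (ornaments A \<times> ornaments B) (ornaments (A + B))"
  proof (rule bij_betw_byWitness[where f' = "\<lambda>\<N>. (filter_mset ?P \<N>, filter_mset ?Q \<N>)"])
    have in_A: "card N \<in># A" if "\<M> \<in> ornaments A" "N \<in># \<M>" for N \<M>
      using that by (auto simp: ornaments_def)
    have in_B: "card N \<notin># A" if "\<M> \<in> ornaments B" "N \<in># \<M>" for N \<M>
      using that disj by (auto simp: ornaments_def)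
    have "filter_mset ?P (\<M> + \<N>) = \<M> \<and> filter_mset ?Q (\<M> + \<N>) = \<N>"
      if "\<M> \<in> ornaments A" "\<N> \<in> ornaments B" for \<M> \<N>
      using in_A[OF that(1)] in_B[OF that(2)]
      by (simp add: filter_mset_all filter_mset_none)
    then show "\<forall>p\<in>ornaments A \<times> ornaments B.
        (filter_mset ?P (case p of (\<M>, \<N>) \<Rightarrow> \<M> + \<N>), filter_mset ?Q (case p of (\<M>, \<N>) \<Rightarrow> \<M> + \<N>)) = p"
      by auto
    show "\<forall>\<N>\<in>ornaments (A + B). (case (filter_mset ?P \<N>, filter_mset ?Q \<N>) of (\<M>, \<N>) \<Rightarrow> \<M> + \<N>) = \<N>"
      by (auto simp: multiset_partition[symmetric])
    show "(\<lambda>(\<M>, \<N>). \<M> + \<N>) ` (ornaments A \<times> ornaments B) \<subseteq> ornaments (A + B)"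
      by (auto simp: ornaments_def)
    show "(\<lambda>\<N>. (filter_mset ?P \<N>, filter_mset ?Q \<N>)) ` ornaments (A + B) \<subseteq> ornaments A \<times> ornaments B"
    proof (rule image_subsetI)
      fix \<N> assume "\<N> \<in> ornaments (A + B)"
      then have \<N>: "set_mset \<N> \<subseteq> necklaces" "image_mset card \<N> = A + B" by (auto simp: ornaments_def)
      have "image_mset card (filter_mset ?P \<N>) = filter_mset (\<lambda>i. i \<in># A) (image_mset card \<N>)"
        "image_mset card (filter_mset ?Q \<N>) = filter_mset (\<lambda>i. i \<notin># A) (image_mset card \<N>)"
        by (simp_all add: filter_mset_image_mset)
      moreover have "filter_mset (\<lambda>i. i \<in># A) (A + B) = A" "filter_mset (\<lambda>i. i \<notin># A) (A + B) = B"
      proof -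
        have "filter_mset (\<lambda>i. i \<in># A) B = {#}" "filter_mset (\<lambda>i. i \<notin># A) B = B"
          using disj by (auto intro!: filter_mset_none filter_mset_all)
        moreover have "filter_mset (\<lambda>i. i \<in># A) A = A" "filter_mset (\<lambda>i. i \<notin># A) A = {#}"
          by (auto intro!: filter_mset_none filter_mset_all)
        ultimately show "filter_mset (\<lambda>i. i \<in># A) (A + B) = A" "filter_mset (\<lambda>i. i \<notin># A) (A + B) = B"
          by simp_all
      qed
      ultimately show "(filter_mset ?P \<N>, filter_mset ?Q \<N>) \<in> ornaments A \<times> ornaments B"
        using \<N> by (auto simp: ornaments_def)
    qed
  qed
  have "gen_fun (ornaments A) ornament_weight * gen_fun (ornaments B) ornament_weight =
      gen_fun (ornaments A \<times> ornaments B) (\<lambda>(\<M>, \<N>). ornament_weight \<M> + ornament_weight \<N>)"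
    by (rule gen_fun_times) (rule finite_fibres_ornaments)+
  also have "\<dots> = gen_fun (ornaments (A + B)) ornament_weight"
    by (rule gen_fun_bij[OF bij]) auto
  finally show ?thesis .
qed

lemma prod_ornaments:
  assumes "finite I"
  shows "(\<Prod>i\<in>I. gen_fun (ornaments (replicate_mset (count lam i) i)) ornament_weight) =
    gen_fun (ornaments (filter_mset (\<lambda>i. i \<in> I) lam)) ornament_weight"
  using assms
proof (induction I rule: finite_induct)
  case empty
  have "ornaments {#} = {{#}}" by (auto simp: ornaments_def)
  then have "gen_fun (ornaments {#}) ornament_weight = 1"
  proof (intro mfps_eqI)
    fix u
    have "{a \<in> {{#}}. ornament_weight a = u} = (if u = {#} then {{#}} else {})" by auto
    then show "mcoeff (gen_fun (ornaments {#}) ornament_weight) u = mcoeff 1 u"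
      by (simp add: mcoeff_gen_fun mcoeff_1 \<open>ornaments {#} = {{#}}\<close> del: sum_mset_0_iff)
  qed
  then show ?case by simp
next
  case (insert i I)
  have "filter_mset (\<lambda>k. k \<in> insert i I) lam = replicate_mset (count lam i) i + filter_mset (\<lambda>k. k \<in> I) lam"
    using insert.hyps(2) by (intro multiset_eqI) auto
  moreover have "set_mset (replicate_mset (count lam i) i) \<inter> set_mset (filter_mset (\<lambda>k. k \<in> I) lam) = {}"
    using insert.hyps(2) by auto
  ultimately show ?case using insert by (simp add: gen_fun_ornaments_times)
qed

theorem sum_Qlam_eq_prod_plethysm:
  assumes "is_partition lam"
  shows "(\<Sum>j=0..sum_mset lam - 1. Qlam lam j * mvar T ^ j) =
    (\<Prod>i=1..sum_mset lam. plethysm (hsym (count lam i)) (\<Sum>j=0..i-1. Qlam {#i#} j * mvar T ^ j))"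
proof -
  have "i \<in> {1..sum_mset lam}" if "i \<in># lam" for i
    using that assms by (cases "i = 0") (auto simp: is_partition_def dest!: multi_member_split)
  then have "filter_mset (\<lambda>i. i \<in> {1..sum_mset lam}) lam = lam"
    by (rule filter_mset_all)
  moreover have "(\<Sum>j=0..i-1. Qlam {#i#} j * mvar T ^ j) = gen_fun (ornaments {#i#}) ornament_weight" for i
    using sum_Qlam[of "{#i#}"] by simp
  ultimately show ?thesis
    using prod_ornaments[of "{1..sum_mset lam}" lam]
    by (simp only: sum_Qlam plethysm_hsym_single_cycle) simp
qed

section \<open>The identity for all permutations\<close>

text \<open>
  The variable \<open>z\<close> records the length. It makes fibres finite although all lengths occur.
\<close>

definition config_weight_z :: "(nat \<Rightarrow> nat) \<times> nat list \<Rightarrow> var multiset" where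
  "config_weight_z p = config_weight p + replicate_mset (length (snd p)) Z"

definition necklace_weight_z :: "code set \<Rightarrow> var multiset" where
  "necklace_weight_z N = necklace_weight N + replicate_mset (card N) Z"

lemma necklaces_of_weight_z:
  assumes "p \<in> configs"
  shows "(\<Sum>N\<in>#necklaces_of p. necklace_weight_z N) = config_weight_z p"
proof -
  obtain \<sigma> w where p: "p = (\<sigma>, w)" by fastforce
  have "(\<Sum>N\<in>#\<N>. replicate_mset (card N) Z) = replicate_mset (\<Sum>N\<in>#\<N>. card N) Z" for \<N> :: "code set multiset"
    by (induction \<N>) (auto intro!: multiset_eqI)
  then show ?thesis
    using assms length_necklaces_of[of \<sigma> w] necklaces_of_weight[of \<sigma> w]
    by (simp add: p necklace_weight_z_def config_weight_z_def sum_mset.distrib)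
qed

lemma finite_fibres_configs: "finite_fibres configs config_weight_z"
  unfolding finite_fibres_def
proof
  fix u
  let ?n = "count u Z"
  have "count (mset (map X w)) Z = 0" for w by (induction w) auto
  then have sub: "{p \<in> configs. config_weight_z p = u}
      \<subseteq> {\<sigma>. \<sigma> permutes {1..?n}} \<times> {w. set w \<subseteq> X -` set_mset u \<and> length w = ?n}"
    by (auto simp: configs_def config_weight_z_def config_weight_def fqs_words_def)
  have "finite (X -` set_mset u)" by (rule finite_vimageI) (auto intro: injI)
  then show "finite {p \<in> configs. config_weight_z p = u}"
    by (intro finite_subset[OF sub] finite_cartesian_product finite_permutations finite_lists_length_eq)
       auto
qed

lemma Fqs_sum_tz:
  "(\<Sum>\<sigma> | \<sigma> permutes {1..n} \<and> exc n \<sigma> = j \<and> P n \<sigma>. Fqs (DEX n \<sigma>) n) * mvar T ^ j * mvar Z ^ n =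
    gen_fun {(\<sigma>, w) \<in> configs. length w = n \<and> exc n \<sigma> = j \<and> P n \<sigma>} config_weight_z"
proof -
  let ?B = "{\<sigma>. \<sigma> permutes {1..n} \<and> exc n \<sigma> = j \<and> P n \<sigma>}"
  have set: "{(\<sigma>, w) \<in> configs. length w = n \<and> exc n \<sigma> = j \<and> P n \<sigma>} = (SIGMA \<sigma>:?B. fqs_words (DEX n \<sigma>) n)"
    by (auto simp: configs_def fqs_words_def)
  have "(\<Sum>\<sigma>\<in>?B. Fqs (DEX n \<sigma>) n) * mvar T ^ j * mvar Z ^ n =
      (\<Sum>\<sigma>\<in>?B. Fqs (DEX n \<sigma>) n * monom (replicate_mset j T + replicate_mset n Z))"
    by (simp add: mvar_power sum_distrib_right mult.assoc monom_mult)
  also have "\<dots> = gen_fun (SIGMA \<sigma>:?B. fqs_words (DEX n \<sigma>) n)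
      (\<lambda>(\<sigma>, w). mset (map X w) + (replicate_mset j T + replicate_mset n Z))"
    by (rule sum_Fqs_times_monom[OF finite_permutes])
  also have "\<dots> = gen_fun (SIGMA \<sigma>:?B. fqs_words (DEX n \<sigma>) n) config_weight_z"
    by (rule gen_fun_bij[OF bij_betw_id])
       (auto simp: config_weight_z_def config_weight_def fqs_words_def)
  finally show ?thesis unfolding set .
qed

text \<open>
  The predicate \<open>P\<close> allows one computation for both double series of the second identity: all
  permutations, and those that consist of a single cycle.
\<close>

lemma formal_sum_Fqs_tz:
  "formal_sum (\<lambda>(n, j). (\<Sum>\<sigma> | \<sigma> permutes {1..n} \<and> exc n \<sigma> = j \<and> P n \<sigma>. Fqs (DEX n \<sigma>) n)
      * mvar T ^ j * mvar Z ^ n) (I \<times> UNIV) =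
    gen_fun {(\<sigma>, w) \<in> configs. length w \<in> I \<and> P (length w) \<sigma>} config_weight_z"
proof -
  let ?A = "\<lambda>(n, j). {(\<sigma>, w) \<in> configs. length w = n \<and> exc n \<sigma> = j \<and> P n \<sigma>}"
  have un: "(\<Union>i\<in>I \<times> UNIV. ?A i) = {(\<sigma>, w) \<in> configs. length w \<in> I \<and> P (length w) \<sigma>}" by auto
  have "formal_sum (\<lambda>i. gen_fun (?A i) config_weight_z) (I \<times> UNIV) = gen_fun (\<Union>i\<in>I \<times> UNIV. ?A i) config_weight_z"
  proof (rule formal_sum_gen_fun)
    show "finite_fibres (\<Union>i\<in>I \<times> UNIV. ?A i) config_weight_z"
      by (rule finite_fibres_subset[OF finite_fibres_configs]) auto
    show "disjoint_family_on ?A (I \<times> UNIV)" by (auto simp: disjoint_family_on_def)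
  qed
  moreover have "(\<lambda>(n, j). (\<Sum>\<sigma> | \<sigma> permutes {1..n} \<and> exc n \<sigma> = j \<and> P n \<sigma>. Fqs (DEX n \<sigma>) n)
      * mvar T ^ j * mvar Z ^ n) = (\<lambda>i. gen_fun (?A i) config_weight_z)"
    unfolding Fqs_sum_tz by (simp add: fun_eq_iff)
  ultimately show ?thesis unfolding un by simp
qed

text \<open>
  The convention \<open>Q\<^bsub>0,0\<^esub> = 1\<close> agrees with the general sum, taken over the permutation of the empty
  set and the empty word. The conjunct \<open>True\<close> is the trivial instance of the predicate in
  \<open>formal_sum_Fqs_tz\<close>.
\<close>

lemma Qn_eq: "Qn n j = (\<Sum>\<sigma> | \<sigma> permutes {1..n} \<and> exc n \<sigma> = j \<and> True. Fqs (DEX n \<sigma>) n)"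
proof (cases "n = 0")
  case True
  have "fqs_words (DEX 0 id) 0 = {[]}" by (auto simp: fqs_words_def DEX_def)
  then have "Fqs (DEX 0 id) 0 = 1"
    using Fqs_times_monom[of "DEX 0 id" 0 "{#}"]
    by (intro mfps_eqI) (simp add: mcoeff_Fqs mcoeff_1 Collect_conv_if)
  moreover have "exc 0 id = 0" by (simp add: exc_def EXC_def)
  moreover have "{\<sigma>. \<sigma> permutes {1..n} \<and> exc n \<sigma> = j \<and> True} = (if exc 0 id = j then {id} else {})"
    using True by auto
  ultimately show ?thesis using True by (simp add: Qn_def)
qed (simp add: Qn_def)

lemma Qlam_single: "Qlam {#i#} j =
  (\<Sum>\<sigma> | \<sigma> permutes {1..i} \<and> exc i \<sigma> = j \<and> cycle_type i \<sigma> = {#i#}. Fqs (DEX i \<sigma>) i)"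
  by (simp add: Qlam_def)

lemma sum_Qn_tz:
  "formal_sum (\<lambda>(n, j). Qn n j * mvar T ^ j * mvar Z ^ n) UNIV = gen_fun configs config_weight_z"
  using formal_sum_Fqs_tz[of "\<lambda>_ _. True" UNIV] by (simp only: Qn_eq UNIV_Times_UNIV) simp

lemma cycle_type_single_iff:
  assumes "(\<sigma>, w) \<in> configs"
  shows "length w \<in> {1..} \<and> cycle_type (length w) \<sigma> = {#length w#} \<longleftrightarrow> size (necklaces_of (\<sigma>, w)) = 1"
proof
  assume "length w \<in> {1..} \<and> cycle_type (length w) \<sigma> = {#length w#}"
  then show "size (necklaces_of (\<sigma>, w)) = 1"
    using card_necklaces_of[OF assms] by (metis size_image_mset size_single)
next
  assume "size (necklaces_of (\<sigma>, w)) = 1"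
  then obtain N where N: "necklaces_of (\<sigma>, w) = {#N#}" using size_1_singleton_mset by blast
  then have "length w \<noteq> 0" by (auto simp: necklaces_of_def)
  then show "length w \<in> {1..} \<and> cycle_type (length w) \<sigma> = {#length w#}"
    using length_necklaces_of[OF assms] card_necklaces_of[OF assms] N by simp
qed

lemma sum_Qlam_single_tz:
  "formal_sum (\<lambda>(i, j). Qlam {#i#} j * mvar T ^ j * mvar Z ^ i) ({1..} \<times> UNIV) =
    gen_fun necklaces necklace_weight_z"
  and finite_fibres_necklaces: "finite_fibres necklaces necklace_weight_z"
proof -
  let ?C = "{(\<sigma>, w) \<in> configs. length w \<in> {1..} \<and> cycle_type (length w) \<sigma> = {#length w#}}"
  let ?S = "{\<N> \<in> {\<N>. set_mset \<N> \<subseteq> necklaces}. size \<N> = 1}"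
  have C: "?C = {p \<in> configs. size (necklaces_of p) = 1}"
    using cycle_type_single_iff by auto
  have bij: "bij_betw necklaces_of ?C ?S"
    unfolding C by (rule bij_betw_Collect[OF necklaces_of_bij]) simp
  have single: "bij_betw (\<lambda>N. {#N#}) necklaces ?S"
  proof (rule bij_betwI')
    fix \<N> assume "\<N> \<in> ?S"
    then show "\<exists>N\<in>necklaces. \<N> = {#N#}" using size_1_singleton_mset[of \<N>] by auto
  qed auto
  have wt: "(\<Sum>N\<in>#necklaces_of p. necklace_weight_z N) = config_weight_z p" if "p \<in> ?C" for p
    using that by (intro necklaces_of_weight_z) auto
  have "formal_sum (\<lambda>(i, j). Qlam {#i#} j * mvar T ^ j * mvar Z ^ i) ({1..} \<times> UNIV) = gen_fun ?C config_weight_z"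
    unfolding Qlam_single by (rule formal_sum_Fqs_tz)
  also have "\<dots> = gen_fun ?S (\<lambda>\<N>. \<Sum>N\<in>#\<N>. necklace_weight_z N)"
    by (rule gen_fun_bij[OF bij]) (rule wt)
  also have "\<dots> = gen_fun necklaces necklace_weight_z"
    by (rule gen_fun_bij[OF single, symmetric]) simp
  finally show "formal_sum (\<lambda>(i, j). Qlam {#i#} j * mvar T ^ j * mvar Z ^ i) ({1..} \<times> UNIV) =
    gen_fun necklaces necklace_weight_z" .
  have "finite_fibres ?C config_weight_z"
    by (rule finite_fibres_subset[OF finite_fibres_configs]) auto
  then have "finite_fibres ?S (\<lambda>\<N>. \<Sum>N\<in>#\<N>. necklace_weight_z N)"
    by (rule finite_fibres_bij[OF bij, THEN iffD1, rotated]) (rule wt)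
  then show "finite_fibres necklaces necklace_weight_z"
    by (subst finite_fibres_bij[OF single, where wt' = "\<lambda>\<N>. \<Sum>N\<in>#\<N>. necklace_weight_z N"]) simp_all
qed

lemma sum_plethysm_tz:
  "formal_sum (\<lambda>n. plethysm (hsym n) (gen_fun necklaces necklace_weight_z)) UNIV = gen_fun configs config_weight_z"
proof -
  let ?W = "\<lambda>\<N>. \<Sum>N\<in>#\<N>. necklace_weight_z N"
  let ?A = "\<lambda>n. {\<N>. set_mset \<N> \<subseteq> necklaces \<and> size \<N> = n}"
  have un: "(\<Union>n\<in>UNIV. ?A n) = {\<N>. set_mset \<N> \<subseteq> necklaces}" by auto
  have "formal_sum (\<lambda>n. gen_fun (?A n) ?W) UNIV = gen_fun (\<Union>n\<in>UNIV. ?A n) ?W"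
  proof (rule formal_sum_gen_fun)
    show "finite_fibres (\<Union>n\<in>UNIV. ?A n) ?W"
      unfolding un using finite_fibres_configs
      by (subst finite_fibres_bij[OF necklaces_of_bij, symmetric]) (auto simp: necklaces_of_weight_z)
  qed (auto simp: disjoint_family_on_def)
  also have "\<dots> = gen_fun configs config_weight_z"
    unfolding un by (rule gen_fun_bij[OF necklaces_of_bij, symmetric]) (rule necklaces_of_weight_z)
  finally show ?thesis by (simp only: plethysm_hsym_gen_fun[OF finite_fibres_necklaces])
qed

theorem corollary6p1:
  shows "(\<forall>lam. is_partition lam \<and> lam \<noteq> {#} \<longrightarrow>
            (\<Sum>j=0..sum_mset lam - 1. Qlam lam j * mvar T ^ j) =
            (\<Prod>i=1..sum_mset lam.
               plethysm (hsym (count lam i)) (\<Sum>j=0..i-1. Qlam {#i#} j * mvar T ^ j))) \<and>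
         formal_sum (\<lambda>(n, j). Qn n j * mvar T ^ j * mvar Z ^ n) UNIV =
         formal_sum (\<lambda>n. plethysm (hsym n)
            (formal_sum (\<lambda>(i, j). Qlam {#i#} j * mvar T ^ j * mvar Z ^ i) ({1..} \<times> UNIV))) UNIV"
  using sum_Qlam_eq_prod_plethysm unfolding sum_Qn_tz sum_Qlam_single_tz sum_plethysm_tz by blast

end
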